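(* There are absolute constants $C,c>0$ such that for every sufficiently large integer $n$ there is a partial concept class $\mathbb{H}_n\subseteq\{0,1,\star\}^{[n]}$ such that (i) for every $\mathcal{X}'\subseteq[n]$, the restriction $\mathbb{H}_n|_{\mathcal{X}'}$ has a disambiguation of size at most $C|\mathcal{X}'|^2$ (polynomial growth with parameter $2$), and (ii) every disambiguation $\overline{\mathbb{H}}$ of $\mathbb{H}_n$ has $\mathrm{VC}(\overline{\mathbb{H}})\ge c\log\log n$. Consequently, there exists a partial concept class $\mathbb{H}_\infty\subseteq\{0,1,\star\}^{\mathbb{N}}$ with polynomial growth with parameter $2$ (i.e., there is a constant $C$ such that for every finite $\mathcal{X}'\subseteq\mathbb{N}$, $\mathbb{H}_\infty|_{\mathcal{X}'}$ has a disambiguation of size at most $C|\mathcal{X}'|^2$) such that every disambiguation of $\mathbb{H}_\infty$ has infinite VC dimension.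
   Context: A partial concept class on a domain $\mathcal{X}$ is a set $\mathbb{H}\subseteq\{0,1,\star\}^{\mathcal{X}}$; for $\mathcal{X}'\subseteq\mathcal{X}$ the restriction is $\mathbb{H}|_{\mathcal{X}'}=\{h|_{\mathcal{X}'}:h\in\mathbb{H}\}$. A finite set $\{x_1,\dots,x_d\}$ is shattered by $\mathbb{H}$ if every $y\in\{0,1\}^d$ is realized as $(h(x_1),\dots,h(x_d))$ for some $h\in\mathbb{H}$; $\mathrm{VC}(\mathbb{H})$ is the largest size of a shattered set ($\infty$ if unbounded). A disambiguation of $\mathbb{H}$ is a total class $\overline{\mathbb{H}}\subseteq\{0,1\}^{\mathcal{X}}$ such that for every $h\in\mathbb{H}$ and every finite $S\subseteq h^{-1}(\{0,1\})$ there is $\bar h\in\overline{\mathbb{H}}$ agreeing with $h$ on $S$. $[n]=\{1,\dots,n\}$.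
   Formalization: The size bound C|X'|^2 is required only for nonempty X' (in both parts); for X' empty it would demand a disambiguation of size 0, which is impossible for a nonempty class, while the empty class violates the VC lower bound. *)

theory Defs
  imports "HOL-Analysis.Analysis" "HOL-Library.Extended_Real"
begin

text \<open>A partial concept on a domain X is represented as a function
  of type a => bool option: Some False = 0, Some True = 1, None = star.
  Points outside the domain X are canonically mapped to None, so that
  classes over X (and their sizes) are represented uniquely.\<close>

definition partial_class :: "'a set \<Rightarrow> ('a \<Rightarrow> bool option) set \<Rightarrow> bool" where
  "partial_class X H \<longleftrightarrow> (\<forall>h\<in>H. \<forall>x. x \<notin> X \<longrightarrow> h x = None)"

definition total_class :: "'a set \<Rightarrow> ('a \<Rightarrow> bool option) set \<Rightarrow> bool" where
  "total_class X H \<longleftrightarrow> (\<forall>h\<in>H. \<forall>x. (x \<in> X \<longrightarrow> h x \<noteq> None) \<and> (x \<notin> X \<longrightarrow> h x = None))"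

definition restr :: "('a \<Rightarrow> bool option) set \<Rightarrow> 'a set \<Rightarrow> ('a \<Rightarrow> bool option) set" where
  "restr H X' = (\<lambda>h x. if x \<in> X' then h x else None) ` H"

definition disambiguation ::
  "'a set \<Rightarrow> ('a \<Rightarrow> bool option) set \<Rightarrow> ('a \<Rightarrow> bool option) set \<Rightarrow> bool" where
  "disambiguation X H Hbar \<longleftrightarrow> total_class X Hbar \<and>
     (\<forall>h\<in>H. \<forall>S. finite S \<and> S \<subseteq> {x \<in> X. h x \<noteq> None} \<longrightarrow>
        (\<exists>g\<in>Hbar. \<forall>x\<in>S. g x = h x))"

definition shatters :: "('a \<Rightarrow> bool option) set \<Rightarrow> 'a set \<Rightarrow> bool" where
  "shatters H S \<longleftrightarrow> finite S \<and> (\<forall>y :: 'a \<Rightarrow> bool. \<exists>h\<in>H. \<forall>x\<in>S. h x = Some (y x))"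

definition VC :: "('a \<Rightarrow> bool option) set \<Rightarrow> enat" where
  "VC H = Sup {enat (card S) | S. shatters H S}"

end

theory Submission
  imports Defs
begin

text \<open>Read a concept as the biclique between its 1s and its 0s. If these bicliques are edge-disjoint,
  at most \<open>m (m - 1)\<close> concepts take both values on \<open>m\<close> given points, and the others are completed by
  constants: this is the quadratic growth. In a disambiguation the points joined by one of the
  bicliques get distinct columns, so the number of columns is at least the chromatic number of the
  union of the bicliques. With \<open>k\<close> concepts and more than \<open>(k + 1) ^ 2 ^ d\<close> columns, the Sauer--Shelah
  lemma for the dual class yields \<open>2 ^ d\<close> dually shattered concepts, hence \<open>d\<close> shattered points. What is
  needed is thus a counterexample to the Alon--Saks--Seymour conjecture with \<open>log \<chi>\<close> polynomially
  larger than \<open>log k\<close>.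

  It is obtained by lifting an unambiguous DNF of width about \<open>s ^ 3\<close> on whose all-zero input every
  0-certificate has size at least about \<open>s ^ 4\<close>. The DNF comes from a partial function whose 0- and
  1-certificates have size about \<open>s ^ 3\<close>, while certifying that the all-zero input lies outside its
  domain takes size about \<open>s ^ 4\<close>; a cheat sheet makes the certificates unambiguous.\<close>

section \<open>Thin classes\<close>

text \<open>The doubly logarithmic rate: with at most \<open>(2 * r) ^ w\<close> concepts and more
  than \<open>r ^ c\<close> columns, it suffices for shattering \<open>d\<close> points that
  \<open>c\<close> is about \<open>2 ^ (d + 1)\<close> times \<open>w\<close>. Any polynomial gap
  between \<open>w\<close> and \<open>c\<close> lets \<open>d\<close> grow like log s, while the
  number of points stays doubly exponential in \<open>d\<close>. The gap of about one factor
  \<open>s\<close> comes from a point-line configuration. A set of \<open>s ^ 4 / 32\<close>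
  variables can absorb more than half the points of only a few lines, since two lines share at most
  one point; these lines are negated instead of hit, and about \<open>s ^ 3\<close> points hit all
  the others. Only the positive part of a certificate has to avoid the variables fixed by a large
  colour class: every point decodes to zero, so fixed variables already agree with negative
  literals. This explains the role of the all-zero input. Certificates of the same type need not
  conflict, whereas thinness wants any two terms to conflict; the cheat sheet closes this gap and
  costs only a factor polynomial in log s in the width.\<close>

definition thin :: "('p \<Rightarrow> bool option) set \<Rightarrow> bool" where
  "thin H \<longleftrightarrow> (\<forall>h\<in>H. \<forall>h'\<in>H. \<forall>x y. h x = Some True \<and> h' x = Some True \<and>
     h y = Some False \<and> h' y = Some False \<longrightarrow> h = h')"

lemma thin_restr_disambiguation:
  fixes H :: "('p \<Rightarrow> bool option) set"
  assumes "thin H" "finite X" "X \<noteq> {}"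
  shows "\<exists>Hbar. disambiguation X (restr H X) Hbar \<and> finite Hbar \<and>
    real (card Hbar) \<le> 2 * real (card X) ^ 2"
proof -
  define M where "M = {h\<in>H. \<exists>x\<in>X. \<exists>y\<in>X. h x = Some True \<and> h y = Some False}"
  define cst where "cst = (\<lambda>v x. if x \<in> X then Some v else (None :: bool option))"
  define fill where "fill = (\<lambda>h x. if x \<in> X then
      (case h x of None \<Rightarrow> Some False | Some v \<Rightarrow> Some v) else (None :: bool option))"
  \<comment> \<open>\<open>thin\<close> treats bicliques as oriented: the pair records which point
    gets 1. Hence ordered pairs off the diagonal are counted.\<close>
  define sep where "sep = (\<lambda>h. SOME p. p \<in> X \<times> X \<and> h (fst p) = Some True \<and> h (snd p) = Some False)"
  let ?D = "X \<times> X - (\<lambda>x. (x, x)) ` X"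
  have sep: "sep h \<in> X \<times> X \<and> h (fst (sep h)) = Some True \<and> h (snd (sep h)) = Some False" if "h \<in> M" for h
  proof -
    have "\<exists>p. p \<in> X \<times> X \<and> h (fst p) = Some True \<and> h (snd p) = Some False"
      using that by (force simp: M_def)
    then show ?thesis unfolding sep_def by (rule someI_ex)
  qed
  have inj: "inj_on sep M"
  proof (rule inj_onI)
    fix h h' assume "h \<in> M" "h' \<in> M" "sep h = sep h'"
    then show "h = h'"
      using sep[of h] sep[of h'] assms(1) by (simp add: thin_def M_def) blast
  qed
  have sub: "sep ` M \<subseteq> ?D"
    using sep by fastforce
  have finD: "finite ?D" using assms by simp
  have finM: "finite M" using inj sub finD by (meson finite_imageD finite_subset)
  have "card M \<le> card ?D" using card_inj_on_le[OF inj sub finD] .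
  also have "card ?D = card X * card X - card X"
  proof -
    have "card ?D = card (X \<times> X) - card ((\<lambda>x. (x, x)) ` X)"
      by (rule card_Diff_subset) (use assms in auto)
    also have "card ((\<lambda>x. (x, x)) ` X) = card X" by (rule card_image) (auto simp: inj_on_def)
    finally show ?thesis by (simp add: card_cartesian_product)
  qed
  finally have cM: "card M \<le> card X * card X - card X" .
  define Hbar where "Hbar = {cst True, cst False} \<union> fill ` M"
  have "card Hbar \<le> 2 + card M"
    unfolding Hbar_def using card_Un_le[of "{cst True, cst False}" "fill ` M"]
      card_image_le[OF finM, of fill] card_insert_le_m1[of 2 "{cst False}" "cst True"] by simp
  moreover have "1 \<le> card X" using assms by (simp add: Suc_le_eq card_gt_0_iff)
  \<comment> \<open>The two constant completions are absorbed here; for one point this is an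
    equality, which is where the factor 2 comes from.\<close>
  moreover have "2 + (n * n - n) \<le> 2 * (n * n)" if "1 \<le> n" for n :: nat
    using that by (cases n) (auto simp: algebra_simps)
  ultimately have "card Hbar \<le> 2 * (card X * card X)" using cM by (meson add_left_mono order_trans)
  then have "real (card Hbar) \<le> real (2 * (card X * card X))" by (rule of_nat_mono)
  then have c: "real (card Hbar) \<le> 2 * real (card X) ^ 2"
    by (simp add: power2_eq_square)
  have "total_class X Hbar"
    by (auto simp: total_class_def Hbar_def cst_def fill_def split: option.splits)
  moreover have "\<exists>g\<in>Hbar. \<forall>x\<in>S. g x = h x"
    if h: "h \<in> restr H X" and S: "S \<subseteq> {x \<in> X. h x \<noteq> None}" for h S
  proof -
    from h obtain h0 where h0: "h0 \<in> H" "h = (\<lambda>x. if x \<in> X then h0 x else None)"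
      by (auto simp: restr_def)
    consider "h0 \<in> M" | "h0 \<notin> M" "\<forall>x\<in>X. h0 x \<noteq> Some True" | "\<forall>x\<in>X. h0 x \<noteq> Some False"
      using h0(1) unfolding M_def by blast
    then show ?thesis
    proof cases
      case 1
      then have "fill h0 \<in> Hbar" by (simp add: Hbar_def)
      moreover have "\<forall>x\<in>S. fill h0 x = h x"
        using S by (auto simp: fill_def h0(2) split: option.splits)
      ultimately show ?thesis by blast
    next
      case 2
      then have "\<forall>x\<in>S. cst False x = h x"
        using S by (fastforce simp: cst_def h0(2))
      then show ?thesis by (auto simp: Hbar_def)
    next
      case 3
      then have "\<forall>x\<in>S. cst True x = h x"
        using S by (fastforce simp: cst_def h0(2))
      then show ?thesis by (auto simp: Hbar_def)
    qed
  qed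
  ultimately have "disambiguation X (restr H X) Hbar"
    unfolding disambiguation_def by blast
  moreover have "finite Hbar" using finM by (simp add: Hbar_def)
  ultimately show ?thesis using c by blast
qed

section \<open>Shattering\<close>

text \<open>A set of size at most \<open>k\<close> arises in \<open>k\<close> rounds, each adding
  one point or nothing (\<open>None\<close>). The crude bound suffices because only the logarithm of
  the count matters.\<close>

lemma card_subsets_bounded_card:
  assumes "finite X"
  shows "card {S. S \<subseteq> X \<and> card S \<le> k} \<le> (card X + 1) ^ k"
proof (induction k)
  case 0
  have "{S. S \<subseteq> X \<and> card S \<le> 0} \<subseteq> {{}}"
    using assms by (auto simp: finite_subset)
  then show ?case using card_mono[of "{{}}" "{S. S \<subseteq> X \<and> card S \<le> 0}"] by simp
next
  case (Suc k)
  let ?F = "\<lambda>k. {S. S \<subseteq> X \<and> card S \<le> k}"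
  have fin: "finite (?F k)" using assms by simp
  have "?F (Suc k) \<subseteq> (\<lambda>(S, e). case e of None \<Rightarrow> S | Some x \<Rightarrow> insert x S) ` (?F k \<times> insert None (Some ` X))"
  proof
    fix S assume S: "S \<in> ?F (Suc k)"
    show "S \<in> (\<lambda>(S, e). case e of None \<Rightarrow> S | Some x \<Rightarrow> insert x S) ` (?F k \<times> insert None (Some ` X))"
    proof (cases "card S \<le> k")
      case True
      then show ?thesis using S by (force intro!: image_eqI[where x = "(S, None)"])
    next
      case False
      then obtain x where x: "x \<in> S" by fastforce
      have "finite S" using S assms by (auto intro: finite_subset)
      then have "card (S - {x}) \<le> k" using S x by auto
      then show ?thesis using S x
        by (intro image_eqI[where x = "(S - {x}, Some x)"]) auto
    qed
  qed
  then have "card (?F (Suc k)) \<le> card (?F k \<times> insert None (Some ` X))"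
    using fin assms by (meson card_image_le card_mono finite_SigmaI finite_imageI finite_insert order_trans)
  also have "\<dots> = card (?F k) * (card X + 1)"
    using assms by (simp add: card_cartesian_product card_image)
  also have "\<dots> \<le> (card X + 1) ^ k * (card X + 1)" using Suc by (intro mult_right_mono) auto
  finally show ?case by (simp add: mult.commute)
qed

text \<open>Pajor's form of the Sauer--Shelah lemma.\<close>

lemma card_le_card_shattered:
  fixes F :: "'a set set"
  assumes "finite X" "F \<subseteq> Pow X"
  shows "card F \<le> card {S. S \<subseteq> X \<and> (\<forall>Y\<subseteq>S. \<exists>f\<in>F. f \<inter> S = Y)}"
  using assms
proof (induction X arbitrary: F rule: finite_induct)
  case empty
  show ?case
  proof (cases "F = {}")
    case False
    then have "F = {{}}" using empty by auto
    then have "{S. S \<subseteq> {} \<and> (\<forall>Y\<subseteq>S. \<exists>f\<in>F. f \<inter> S = Y)} = {{}}" by auto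
    then show ?thesis using \<open>F = {{}}\<close> by simp
  qed simp
next
  case (insert x X)
  let ?Sh = "\<lambda>X F. {S. S \<subseteq> X \<and> (\<forall>Y\<subseteq>S. \<exists>f\<in>F. f \<inter> S = Y)}"
  define F0 where "F0 = {f \<in> F. x \<notin> f}"
  define F1 where "F1 = (\<lambda>f. f - {x}) ` {f \<in> F. x \<in> f}"
  have finF: "finite F" using insert by (meson finite_Pow_iff finite_insert finite_subset)
  have sub: "F0 \<subseteq> Pow X" "F1 \<subseteq> Pow X" using insert by (auto simp: F0_def F1_def)
  have fin01: "finite F0" "finite F1" using finF by (auto simp: F0_def F1_def)
  have "card F = card F0 + card {f \<in> F. x \<in> f}"
    using finF unfolding F0_def
    by (subst card_Un_disjoint[symmetric]) (auto intro!: arg_cong[where f = card])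
  also have "card {f \<in> F. x \<in> f} = card F1"
    unfolding F1_def by (rule card_image[symmetric]) (auto simp: inj_on_def)
  \<comment> \<open>A set shattered by the union is shattered by \<open>F\<close>; one shattered by
    the intersection stays so after adding \<open>x\<close>. Only sets of the second kind contain
    \<open>x\<close>, so nothing is counted twice.\<close>
  also have "card F0 + card F1 = card (F0 \<union> F1) + card (F0 \<inter> F1)"
    using card_Un_Int[OF fin01] .
  also have "\<dots> \<le> card (?Sh X (F0 \<union> F1)) + card (?Sh X (F0 \<inter> F1))"
    using sub by (intro add_mono insert.IH) auto
  also have "card (?Sh X (F0 \<inter> F1)) = card (insert x ` ?Sh X (F0 \<inter> F1))"
    using insert.hyps(2) by (intro card_image[symmetric]) (fastforce simp: inj_on_def)
  also have "card (?Sh X (F0 \<union> F1)) + \<dots> = card (?Sh X (F0 \<union> F1) \<union> insert x ` ?Sh X (F0 \<inter> F1))"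
    using insert.hyps by (intro card_Un_disjoint[symmetric]) auto
  also have "\<dots> \<le> card (?Sh (insert x X) F)"
  proof (rule card_mono)
    show "finite (?Sh (insert x X) F)" using insert.hyps by simp
    show "?Sh X (F0 \<union> F1) \<union> insert x ` ?Sh X (F0 \<inter> F1) \<subseteq> ?Sh (insert x X) F"
    proof (intro Un_least subsetI)
      fix S assume S: "S \<in> ?Sh X (F0 \<union> F1)"
      then have xS: "x \<notin> S" using insert.hyps by auto
      have "\<exists>f\<in>F. f \<inter> S = Y" if Y: "Y \<subseteq> S" for Y
      proof -
        obtain g where g: "g \<in> F0 \<union> F1" "g \<inter> S = Y" using S Y by blast
        then consider "g \<in> F" | f where "f \<in> F" "g = f - {x}" by (auto simp: F0_def F1_def)
        then show ?thesis using g xS by cases auto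
      qed
      then show "S \<in> ?Sh (insert x X) F" using S by auto
    next
      fix S' assume "S' \<in> insert x ` ?Sh X (F0 \<inter> F1)"
      then obtain S where S: "S \<in> ?Sh X (F0 \<inter> F1)" "S' = insert x S" by auto
      then have xS: "x \<notin> S" using insert.hyps by auto
      have "\<exists>f\<in>F. f \<inter> S' = Y" if Y: "Y \<subseteq> S'" for Y
      proof -
        have "Y - {x} \<subseteq> S" using Y S by auto
        then obtain g where g: "g \<in> F0 \<inter> F1" "g \<inter> S = Y - {x}" using S(1) by blast
        then obtain f where f: "f \<in> F" "x \<in> f" "g = f - {x}" by (auto simp: F1_def)
        have "g \<in> F" "x \<notin> g" using g by (auto simp: F0_def)
        show ?thesis
        proof (cases "x \<in> Y")
          case True
          then have "f \<inter> S' = Y" using f g xS S(2) by auto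
          then show ?thesis using f by blast
        next
          case False
          then have "g \<inter> S' = Y" using \<open>x \<notin> g\<close> g xS S(2) by auto
          then show ?thesis using \<open>g \<in> F\<close> by blast
        qed
      qed
      then show "S' \<in> ?Sh (insert x X) F" using S by auto
    qed
  qed
  finally show ?case .
qed

text \<open>Duality: among more than \<open>2 ^ d\<close> concepts shattered by the columns,
  \<open>2 ^ d\<close> are labelled by the subsets of \<open>{..<d}\<close>. The point whose column
  selects the labels containing \<open>i\<close> serves as the \<open>i\<close>-th shattered
  point.\<close>

lemma many_columns_shattered:
  fixes G :: "'r \<Rightarrow> 'p \<Rightarrow> bool"
  assumes fin: "finite R" and many: "(card R + 1) ^ (2 ^ d) < card ((\<lambda>v. {h\<in>R. G h v}) ` V)"
  shows "\<exists>S\<subseteq>V. finite S \<and> card S = d \<and> (\<forall>y. \<exists>h\<in>R. \<forall>x\<in>S. G h x = y x)"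
proof -
  let ?F = "(\<lambda>v. {h\<in>R. G h v}) ` V"
  let ?Sh = "{S. S \<subseteq> R \<and> (\<forall>Y\<subseteq>S. \<exists>f\<in>?F. f \<inter> S = Y)}"
  have "\<not> ?Sh \<subseteq> {S. S \<subseteq> R \<and> card S \<le> 2 ^ d}"
  proof
    assume "?Sh \<subseteq> {S. S \<subseteq> R \<and> card S \<le> 2 ^ d}"
    then have "card ?Sh \<le> card {S. S \<subseteq> R \<and> card S \<le> 2 ^ d}"
      using fin by (intro card_mono) auto
    also have "\<dots> \<le> (card R + 1) ^ (2 ^ d)" by (rule card_subsets_bounded_card[OF fin])
    also have "\<dots> < card ?F" by (rule many)
    also have "card ?F \<le> card ?Sh" by (rule card_le_card_shattered[OF fin]) auto
    finally show False by simp
  qed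
  then obtain Z where Zin: "Z \<in> ?Sh" and Zout: "Z \<notin> {S. S \<subseteq> R \<and> card S \<le> 2 ^ d}"
    by (meson subsetI)
  have Z: "Z \<subseteq> R" "\<forall>Y\<subseteq>Z. \<exists>f\<in>?F. f \<inter> Z = Y"
    using conjunct1[OF CollectD[OF Zin]] conjunct2[OF CollectD[OF Zin]] by - assumption+
  have Z3: "2 ^ d < card Z" using Zout Z(1) by simp
  have "card (Pow {..<d}) \<le> card Z" using Z3 by (simp add: card_Pow)
  moreover have "finite Z" using Z fin finite_subset by blast
  ultimately obtain \<phi> where \<phi>: "\<phi> ` Pow {..<d} \<subseteq> Z" "inj_on \<phi> (Pow {..<d})"
    using card_le_inj[of "Pow {..<d}" Z] by blast
  have "\<exists>v\<in>V. {h\<in>R. G h v} \<inter> Z = \<phi> ` {A\<in>Pow {..<d}. i \<in> A}" for i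
  proof -
    have "\<phi> ` {A\<in>Pow {..<d}. i \<in> A} \<subseteq> Z" using \<phi>(1) by auto
    then have "\<exists>f\<in>?F. f \<inter> Z = \<phi> ` {A\<in>Pow {..<d}. i \<in> A}" using Z(2) by blast
    then show ?thesis by simp
  qed
  then obtain v where v: "\<And>i. v i \<in> V" "\<And>i. {h\<in>R. G h (v i)} \<inter> Z = \<phi> ` {A\<in>Pow {..<d}. i \<in> A}"
    by metis
  have G: "G (\<phi> A) (v i) \<longleftrightarrow> i \<in> A" if A: "A \<subseteq> {..<d}" for A i
  proof -
    have "\<phi> A \<in> Z" using \<phi>(1) A by blast
    then have "G (\<phi> A) (v i) \<longleftrightarrow> \<phi> A \<in> {h\<in>R. G h (v i)} \<inter> Z" using Z(1) by auto
    also have "\<dots> \<longleftrightarrow> i \<in> A"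
      unfolding v(2) using \<phi>(2) A by (auto simp: inj_on_def)
    finally show ?thesis .
  qed
  have inj: "inj_on v {..<d}"
  proof (rule inj_onI)
    fix i j assume "i \<in> {..<d}" "j \<in> {..<d}" "v i = v j"
    moreover from this have "{i} \<subseteq> {..<d}" by simp
    ultimately show "i = j" using G[of "{i}" i] G[of "{i}" j] by (metis singletonD singletonI)
  qed
  have "\<exists>h\<in>R. \<forall>x\<in>v ` {..<d}. G h x = y x" for y
  proof (intro bexI ballI)
    let ?A = "{i\<in>{..<d}. y (v i)}"
    have sub: "?A \<subseteq> {..<d}" by blast
    show "\<phi> ?A \<in> R" using \<phi>(1) Z(1) sub by blast
    fix x assume "x \<in> v ` {..<d}"
    then obtain i where "i < d" "x = v i" by auto
    then show "G (\<phi> ?A) x = y x" using G[OF sub, of i] by simp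
  qed
  then have "\<forall>y. \<exists>h\<in>R. \<forall>x\<in>v ` {..<d}. G h x = y x" by (rule allI)
  moreover have "v ` {..<d} \<subseteq> V" using v(1) by blast
  moreover have "card (v ` {..<d}) = d" using inj by (simp add: card_image)
  moreover have "finite (v ` {..<d})" by simp
  ultimately show ?thesis by (intro exI conjI)
qed

section \<open>Random subsets and blockwise dense sets\<close>

text \<open>The moment bound for a random sign. The sharp exponent is half of
  \<open>x\<^sup>2\<close>; the loss only affects constants.\<close>

lemma exp_add_exp_minus_le:
  fixes x :: real
  assumes "0 \<le> x" "x \<le> 1"
  shows "exp x + exp (- x) \<le> 2 * exp (x\<^sup>2)"
proof -
  have "exp x \<le> 1 + x + x\<^sup>2" using assms by (rule exp_bound)
  moreover have "exp (- x) \<le> 1 - x + x\<^sup>2"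
  proof -
    \<comment> \<open>The product is 1 plus the cube of \<open>x\<close>.\<close>
    have "1 \<le> (1 + x) * (1 - x + x\<^sup>2)"
      using assms by (simp add: algebra_simps power2_eq_square)
    also have "\<dots> \<le> exp x * (1 - x + x\<^sup>2)"
      using assms by (intro mult_right_mono) (auto intro: add_nonneg_nonneg)
    finally have "1 * exp (- x) \<le> exp x * (1 - x + x\<^sup>2) * exp (- x)"
      by (intro mult_right_mono) auto
    also have "\<dots> = (exp x * exp (- x)) * (1 - x + x\<^sup>2)" by (simp only: mult_ac)
    finally show ?thesis by (simp flip: exp_add)
  qed
  moreover have "1 + x\<^sup>2 \<le> exp (x\<^sup>2)" by (rule exp_ge_add_one_self)
  ultimately show ?thesis by linarith
qed

text \<open>A Chernoff bound by counting: for a uniformly random \<open>Y\<close> the difference is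
  a sum of the weights with independent signs, and the squared weights add up to at most
  \<open>b * s\<close>.\<close>

lemma card_subsets_deviation:
  fixes q :: "'a \<Rightarrow> real"
  assumes fin: "finite A" and q: "\<And>a. a \<in> A \<Longrightarrow> 0 \<le> q a" "\<And>a. a \<in> A \<Longrightarrow> q a \<le> b"
    and b: "0 < b" and s: "sum q A \<le> s" and e: "0 < e" "e \<le> 1"
  shows "real (card {Y \<in> Pow A. e * s \<le> sum q Y - sum q (A - Y)})
    \<le> 2 ^ card A * exp (- (e\<^sup>2 * s / (4 * b)))"
proof -
  \<comment> \<open>This value minimizes the exponent
    \<open>l\<^sup>2 * b * s - l * (e * s)\<close>, and \<open>l * b \<le> 1\<close> keeps every
    term in the range of the moment bound.\<close>
  define l where "l = e / (2 * b)"
  define D where "D = (\<lambda>Y. sum q Y - sum q (A - Y))"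
  let ?B = "{Y \<in> Pow A. e * s \<le> D Y}"
  have l: "0 < l" using b e by (simp add: l_def)
  have "(\<Sum>Y\<in>Pow A. exp (l * D Y)) = (\<Sum>Y\<in>Pow A. (\<Prod>a\<in>Y. exp (l * q a)) * (\<Prod>a\<in>A - Y. exp (- (l * q a))))"
  proof (rule sum.cong[OF refl])
    fix Y assume "Y \<in> Pow A"
    then have "finite Y" "finite (A - Y)" using fin finite_subset by auto
    moreover have "l * D Y = (\<Sum>a\<in>Y. l * q a) + (\<Sum>a\<in>A - Y. - (l * q a))"
      by (simp add: D_def sum_negf sum_distrib_left right_diff_distrib)
    ultimately show "exp (l * D Y) = (\<Prod>a\<in>Y. exp (l * q a)) * (\<Prod>a\<in>A - Y. exp (- (l * q a)))"
      by (simp only: exp_add exp_sum)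
  qed
  also have "\<dots> = (\<Prod>a\<in>A. exp (l * q a) + exp (- (l * q a)))"
    by (rule prod_add[OF fin, symmetric])
  also have "\<dots> \<le> (\<Prod>a\<in>A. 2 * exp ((l * q a)\<^sup>2))"
  proof (rule prod_mono, rule conjI)
    fix a assume a: "a \<in> A"
    have "l * q a \<le> l * b" using q(2)[OF a] l by simp
    also have "\<dots> \<le> 1" using b e by (simp add: l_def)
    finally show "exp (l * q a) + exp (- (l * q a)) \<le> 2 * exp ((l * q a)\<^sup>2)"
      using q(1)[OF a] l by (intro exp_add_exp_minus_le) auto
  qed (simp add: add_nonneg_nonneg)
  also have "\<dots> = 2 ^ card A * exp (\<Sum>a\<in>A. (l * q a)\<^sup>2)"
    by (simp add: prod.distrib exp_sum[OF fin])
  also have "\<dots> \<le> 2 ^ card A * exp (l\<^sup>2 * b * s)"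
  proof -
    have "(\<Sum>a\<in>A. (l * q a)\<^sup>2) \<le> (\<Sum>a\<in>A. l\<^sup>2 * b * q a)"
    proof (rule sum_mono)
      fix a assume a: "a \<in> A"
      have "q a * q a \<le> b * q a" using q[OF a] by (intro mult_right_mono) auto
      then have "l\<^sup>2 * (q a * q a) \<le> l\<^sup>2 * (b * q a)" by (intro mult_left_mono) auto
      then show "(l * q a)\<^sup>2 \<le> l\<^sup>2 * b * q a" by (simp add: power2_eq_square mult_ac)
    qed
    also have "\<dots> = l\<^sup>2 * b * sum q A" by (simp add: sum_distrib_left)
    also have "\<dots> \<le> l\<^sup>2 * b * s" using s b by (intro mult_left_mono) auto
    finally show ?thesis by simp
  qed
  finally have total: "(\<Sum>Y\<in>Pow A. exp (l * D Y)) \<le> 2 ^ card A * exp (l\<^sup>2 * b * s)" .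
  have "real (card ?B) * exp (l * (e * s)) = (\<Sum>Y\<in>?B. exp (l * (e * s)))" by simp
  also have "\<dots> \<le> (\<Sum>Y\<in>?B. exp (l * D Y))" using l by (intro sum_mono) simp
  also have "\<dots> \<le> (\<Sum>Y\<in>Pow A. exp (l * D Y))" using fin by (intro sum_mono2) auto
  also note total
  finally have "real (card ?B) \<le> 2 ^ card A * exp (l\<^sup>2 * b * s) / exp (l * (e * s))"
    by (simp add: pos_le_divide_eq)
  also have "\<dots> = 2 ^ card A * exp (l\<^sup>2 * b * s - l * (e * s))" by (simp add: exp_diff)
  also have "l\<^sup>2 * b * s - l * (e * s) = - (e\<^sup>2 * s / (4 * b))"
    using b by (simp add: l_def field_simps power2_eq_square)
  finally show ?thesis by (simp add: D_def)
qed

lemma card_subsets_abs_deviation: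
  fixes q :: "'a \<Rightarrow> real"
  assumes fin: "finite A" and q: "\<And>a. a \<in> A \<Longrightarrow> 0 \<le> q a" "\<And>a. a \<in> A \<Longrightarrow> q a \<le> b"
    and b: "0 < b" and s: "sum q A \<le> s" and e: "0 < e" "e \<le> 1"
  shows "real (card {Y \<in> Pow A. e * s \<le> \<bar>sum q Y - sum q (A - Y)\<bar>})
    \<le> 2 * 2 ^ card A * exp (- (e\<^sup>2 * s / (4 * b)))"
proof -
  let ?B = "{Y \<in> Pow A. e * s \<le> sum q Y - sum q (A - Y)}"
  have fB: "finite ?B" using fin by simp
  have "{Y \<in> Pow A. e * s \<le> \<bar>sum q Y - sum q (A - Y)\<bar>} \<subseteq> ?B \<union> (\<lambda>Y. A - Y) ` ?B"
  proof
    fix Y assume Y: "Y \<in> {Y \<in> Pow A. e * s \<le> \<bar>sum q Y - sum q (A - Y)\<bar>}"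
    then have "A - (A - Y) = Y" by auto
    show "Y \<in> ?B \<union> (\<lambda>Y. A - Y) ` ?B"
    proof (cases "Y \<in> ?B")
      case False
      then have "A - Y \<in> ?B" using Y \<open>A - (A - Y) = Y\<close> by auto
      moreover have "Y = A - (A - Y)" using \<open>A - (A - Y) = Y\<close> by (rule sym)
      ultimately show ?thesis by (intro UnI2 rev_image_eqI)
    qed simp
  qed
  then have "card {Y \<in> Pow A. e * s \<le> \<bar>sum q Y - sum q (A - Y)\<bar>} \<le> card (?B \<union> (\<lambda>Y. A - Y) ` ?B)"
    using fB by (intro card_mono) auto
  also have "\<dots> \<le> card ?B + card ?B"
    by (rule order_trans[OF card_Un_le add_left_mono[OF card_image_le[OF fB]]])
  finally have "real (card {Y \<in> Pow A. e * s \<le> \<bar>sum q Y - sum q (A - Y)\<bar>}) \<le> 2 * real (card ?B)"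
    by simp
  also have "\<dots> \<le> 2 * (2 ^ card A * exp (- (e\<^sup>2 * s / (4 * b))))"
    by (intro mult_left_mono card_subsets_deviation assms) auto
  finally show ?thesis by simp
qed

text \<open>For random \<open>Y\<close>, a pattern on \<open>S\<close> splits according to the value
  at \<open>u\<close>. Density on \<open>insert u S\<close> makes each part small, so
  \<open>Y\<close> and its complement receive nearly equal shares. The factor
  \<open>(2 * r) ^ w\<close> is the union bound over all patterns.\<close>

lemma card_step_bad:
  fixes A :: "('u \<Rightarrow> nat) set" and \<sigma> :: bool
  assumes fin: "finite A" "finite J" and w: "card J \<le> w" and u: "u \<notin> J"
    and rng: "\<And>x v. x \<in> A \<Longrightarrow> v \<in> insert u J \<Longrightarrow> x v < r" and r: "1 \<le> r"
    and K: "0 < K" and t: "0 < t" and e: "0 < e" "e \<le> 1"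
    and upper: "\<And>S \<beta>. S \<subseteq> insert u J \<Longrightarrow> real (card {x\<in>A. \<forall>v\<in>S. x v = \<beta> v}) \<le> K * (1 / t) ^ card S"
    and lower: "lam * K \<le> real (card A)"
  defines "Am \<equiv> (\<lambda>Y. {x\<in>A. (x u \<in> Y) = \<sigma>})"
  shows "real (card {Y \<in> Pow {..<r}. \<not> ((\<forall>S \<beta>. S \<subseteq> J \<longrightarrow>
      real (card {x\<in>Am Y. \<forall>v\<in>S. x v = \<beta> v}) \<le> (K * (1 + e) / 2) * (1 / t) ^ card S) \<and>
      (lam - e) * K / 2 \<le> real (card (Am Y)))})
    \<le> 2 ^ r * (2 * (2 * real r) ^ w * exp (- (e\<^sup>2 * t / 4)))"
proof -
  define q where "q = (\<lambda>S \<beta> a. real (card {x\<in>A. x u = a \<and> (\<forall>v\<in>S. x v = \<beta> v)}))"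
  define s where "s = (\<lambda>S :: 'u set. K * (1 / t) ^ card S)"
  define Dv where "Dv = (\<lambda>S \<beta>. {Y \<in> Pow {..<r}. e * s S \<le> \<bar>sum (q S \<beta>) Y - sum (q S \<beta>) ({..<r} - Y)\<bar>})"
  have s0: "0 < s S" for S using K t by (simp add: s_def)
  have count: "real (card {x\<in>A. x u \<in> Y \<and> (\<forall>v\<in>S. x v = \<beta> v)}) = sum (q S \<beta>) Y"
    if "Y \<subseteq> {..<r}" for Y S \<beta>
  proof -
    have finY: "finite Y" using that finite_subset by blast
    have "{x\<in>A. x u \<in> Y \<and> (\<forall>v\<in>S. x v = \<beta> v)} = (\<Union>a\<in>Y. {x\<in>A. x u = a \<and> (\<forall>v\<in>S. x v = \<beta> v)})" by auto
    then have "card {x\<in>A. x u \<in> Y \<and> (\<forall>v\<in>S. x v = \<beta> v)} = (\<Sum>a\<in>Y. card {x\<in>A. x u = a \<and> (\<forall>v\<in>S. x v = \<beta> v)})"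
      using fin finY by (simp only:) (rule card_UN_disjoint, auto)
    then show ?thesis by (simp add: q_def)
  qed
  have dev: "real (card (Dv S \<beta>)) \<le> 2 * 2 ^ r * exp (- (e\<^sup>2 * t / 4))" if S: "S \<subseteq> J" for S \<beta>
  proof -
    have finS: "finite S" using S fin finite_subset by blast
    have uS: "u \<notin> S" using S u by blast
    \<comment> \<open>A single value at \<open>u\<close> carries at most a \<open>1 / t\<close>
      fraction of the bound \<open>s S\<close>; the exponent therefore does not depend on
      \<open>S\<close>.\<close>
    have "real (card (Dv S \<beta>)) \<le> 2 * 2 ^ card {..<r} * exp (- (e\<^sup>2 * s S / (4 * (s S / t))))"
      unfolding Dv_def
    proof (rule card_subsets_abs_deviation)
      fix a
      have "q S \<beta> a \<le> real (card {x\<in>A. \<forall>v\<in>insert u S. x v = (\<beta>(u := a)) v})"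
        unfolding q_def using fin uS by (intro of_nat_mono card_mono) auto
      also have "\<dots> \<le> K * (1 / t) ^ card (insert u S)"
        using S by (intro upper) auto
      also have "\<dots> = s S / t" using finS uS by (simp add: s_def)
      finally show "q S \<beta> a \<le> s S / t" .
    next
      have "sum (q S \<beta>) {..<r} = real (card {x\<in>A. x u \<in> {..<r} \<and> (\<forall>v\<in>S. x v = \<beta> v)})"
        by (rule count[symmetric]) simp
      also have "\<dots> \<le> real (card {x\<in>A. \<forall>v\<in>S. x v = \<beta> v})"
        using fin by (intro of_nat_mono card_mono) auto
      also have "\<dots> \<le> s S" unfolding s_def using S by (intro upper) auto
      finally show "sum (q S \<beta>) {..<r} \<le> s S" .
    qed (use e t s0[of S] in \<open>auto simp: q_def\<close>)
    then show ?thesis using s0[of S] t by simp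
  qed
  let ?I = "SIGMA S:Pow J. S \<rightarrow>\<^sub>E {..<r}"
  have finI: "finite ?I" using fin by (intro finite_SigmaI finite_PiE) (auto intro: finite_subset)
  have cardI: "real (card ?I) \<le> (2 * real r) ^ w"
  proof -
    have "card ?I = (\<Sum>S\<in>Pow J. card (S \<rightarrow>\<^sub>E {..<r}))"
      using fin by (intro card_SigmaI) (auto intro!: finite_PiE intro: finite_subset)
    also have "\<dots> \<le> (\<Sum>S\<in>Pow J. r ^ w)"
    proof (rule sum_mono)
      fix S assume S: "S \<in> Pow J"
      then have "finite S" "card S \<le> w" using fin w card_mono[of J S] finite_subset by auto
      then show "card (S \<rightarrow>\<^sub>E {..<r}) \<le> r ^ w" using r by (simp add: card_PiE power_increasing)
    qed
    also have "\<dots> = 2 ^ card J * r ^ w" using fin by (simp add: card_Pow)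
    also have "\<dots> \<le> 2 ^ w * r ^ w" using w by (intro mult_right_mono power_increasing) auto
    finally have "real (card ?I) \<le> real (2 ^ w * r ^ w)" by (rule of_nat_mono)
    then show ?thesis by (simp add: power_mult_distrib)
  qed
  have good: "(\<forall>S \<beta>. S \<subseteq> J \<longrightarrow>
      real (card {x\<in>Am Y. \<forall>v\<in>S. x v = \<beta> v}) \<le> (K * (1 + e) / 2) * (1 / t) ^ card S) \<and>
      (lam - e) * K / 2 \<le> real (card (Am Y))"
    if Y: "Y \<subseteq> {..<r}" and nb: "\<forall>(S, \<beta>)\<in>?I. Y \<notin> Dv S \<beta>" for Y
  proof -
    have small: "\<bar>sum (q S \<beta>) Y - sum (q S \<beta>) ({..<r} - Y)\<bar> < e * s S"
      if "S \<subseteq> J" "\<beta> \<in> S \<rightarrow>\<^sub>E {..<r}" for S \<beta>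
      using nb that Y by (auto simp: Dv_def not_le)
    have Amc: "real (card {x\<in>Am Y. \<forall>v\<in>S. x v = \<beta> v}) =
      (if \<sigma> then sum (q S \<beta>) Y else sum (q S \<beta>) ({..<r} - Y))" for S \<beta>
    proof (cases \<sigma>)
      case True
      have "{x\<in>Am Y. \<forall>v\<in>S. x v = \<beta> v} = {x\<in>A. x u \<in> Y \<and> (\<forall>v\<in>S. x v = \<beta> v)}"
        using True by (auto simp: Am_def)
      then show ?thesis using count[OF Y] True by simp
    next
      case False
      have "{x\<in>Am Y. \<forall>v\<in>S. x v = \<beta> v} = {x\<in>A. x u \<in> {..<r} - Y \<and> (\<forall>v\<in>S. x v = \<beta> v)}"
        using False rng by (auto simp: Am_def)
      then show ?thesis using count[of "{..<r} - Y"] False by simp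
    qed
    have tot: "sum (q S \<beta>) Y + sum (q S \<beta>) ({..<r} - Y) = real (card {x\<in>A. \<forall>v\<in>S. x v = \<beta> v})" for S \<beta>
    proof -
      have "sum (q S \<beta>) Y + sum (q S \<beta>) ({..<r} - Y) = sum (q S \<beta>) {..<r}"
        using Y by (metis add.commute finite_lessThan sum.subset_diff)
      also have "\<dots> = real (card {x\<in>A. x u \<in> {..<r} \<and> (\<forall>v\<in>S. x v = \<beta> v)})"
        by (rule count[symmetric]) simp
      also have "{x\<in>A. x u \<in> {..<r} \<and> (\<forall>v\<in>S. x v = \<beta> v)} = {x\<in>A. \<forall>v\<in>S. x v = \<beta> v}"
        using rng by auto
      finally show ?thesis .
    qed
    have "real (card {x\<in>Am Y. \<forall>v\<in>S. x v = \<beta> v}) \<le> (K * (1 + e) / 2) * (1 / t) ^ card S"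
      if S: "S \<subseteq> J" for S \<beta>
    \<comment> \<open>The union bound covers only extensional patterns with values below
      \<open>r\<close>. A pattern that some \<open>x\<close> realizes agrees on \<open>S\<close>
      with one of these; all other patterns have count zero.\<close>
    proof (cases "{x\<in>Am Y. \<forall>v\<in>S. x v = \<beta> v} = {}")
      case True
      then have "card {x\<in>Am Y. \<forall>v\<in>S. x v = \<beta> v} = 0" by (simp only: card.empty)
      then show ?thesis using K e t by simp
    next
      case False
      then obtain x where x: "x \<in> Am Y" "\<forall>v\<in>S. x v = \<beta> v" by auto
      define \<beta>' where "\<beta>' = restrict \<beta> S"
      have "\<beta> v < r" if "v \<in> S" for v
      proof -
        have "x \<in> A" "v \<in> insert u J" using x that S by (auto simp: Am_def)
        then show ?thesis using rng[of x v] x(2) that by simp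
      qed
      then have "\<beta>' \<in> S \<rightarrow>\<^sub>E {..<r}" by (simp add: \<beta>'_def)
      note sm = small[OF S this]
      have "real (card {x\<in>A. \<forall>v\<in>S. x v = \<beta>' v}) \<le> s S"
        unfolding s_def using S by (intro upper) auto
      then have "real (card {x\<in>Am Y. \<forall>v\<in>S. x v = \<beta>' v}) \<le> (s S + e * s S) / 2"
        using sm unfolding Amc tot[of S \<beta>', symmetric] abs_less_iff by (cases \<sigma>) simp_all
      also have "\<dots> = (K * (1 + e) / 2) * (1 / t) ^ card S" by (simp add: s_def algebra_simps)
      also have "{x\<in>Am Y. \<forall>v\<in>S. x v = \<beta>' v} = {x\<in>Am Y. \<forall>v\<in>S. x v = \<beta> v}"
        by (auto simp: \<beta>'_def)
      finally show ?thesis .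
    qed
    moreover have "(lam - e) * K / 2 \<le> real (card (Am Y))"
    proof -
      \<comment> \<open>The lower bound is the case of the empty pattern, whose only extensional
        representative is this function.\<close>
      have "(\<lambda>_. undefined) \<in> {} \<rightarrow>\<^sub>E {..<r}" by simp
      then have "\<bar>sum (q {} (\<lambda>_. undefined)) Y - sum (q {} (\<lambda>_. undefined)) ({..<r} - Y)\<bar> < e * s {}"
        by (intro small) simp_all
      moreover have "real (card A) = sum (q {} (\<lambda>_. undefined)) Y + sum (q {} (\<lambda>_. undefined)) ({..<r} - Y)"
        using tot[of "{}" "\<lambda>_. undefined"] by simp
      moreover have "real (card (Am Y)) = (if \<sigma> then sum (q {} (\<lambda>_. undefined)) Y else sum (q {} (\<lambda>_. undefined)) ({..<r} - Y))"
        using Amc[of "{}" "\<lambda>_. undefined"] by simp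
    ultimately have "(real (card A) - e * K) / 2 \<le> real (card (Am Y))"
        unfolding abs_less_iff by (cases \<sigma>) (simp_all add: s_def)
      then show ?thesis using lower by (simp add: algebra_simps)
    qed
    ultimately show ?thesis by (intro conjI allI impI)
  qed
  let ?Bad = "{Y \<in> Pow {..<r}. \<not> ((\<forall>S \<beta>. S \<subseteq> J \<longrightarrow>
      real (card {x\<in>Am Y. \<forall>v\<in>S. x v = \<beta> v}) \<le> (K * (1 + e) / 2) * (1 / t) ^ card S) \<and>
      (lam - e) * K / 2 \<le> real (card (Am Y)))}"
  have "?Bad \<subseteq> (\<Union>(S, \<beta>)\<in>?I. Dv S \<beta>)"
  proof
    fix Y assume Y: "Y \<in> ?Bad"
    show "Y \<in> (\<Union>(S, \<beta>)\<in>?I. Dv S \<beta>)"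
    proof (rule ccontr)
      assume "Y \<notin> (\<Union>(S, \<beta>)\<in>?I. Dv S \<beta>)"
      then have nb: "\<forall>(S, \<beta>)\<in>?I. Y \<notin> Dv S \<beta>" by auto
      have "Y \<subseteq> {..<r}" using Y by simp
      then show False by (rule notE[OF conjunct2[OF CollectD[OF Y]] good[OF _ nb]])
    qed
  qed
  moreover have finDv: "finite (Dv S \<beta>)" for S \<beta>
    by (rule finite_subset[of _ "Pow {..<r}"]) (auto simp: Dv_def)
  ultimately have "card ?Bad \<le> card (\<Union>(S, \<beta>)\<in>?I. Dv S \<beta>)"
    using finI by (intro card_mono finite_UN_I) auto
  also have "\<dots> \<le> (\<Sum>p\<in>?I. card (case p of (S, \<beta>) \<Rightarrow> Dv S \<beta>))" by (rule card_UN_le[OF finI])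
  finally have "real (card ?Bad) \<le> real (\<Sum>p\<in>?I. card (case p of (S, \<beta>) \<Rightarrow> Dv S \<beta>))"
    by (rule of_nat_mono)
  also have "\<dots> = (\<Sum>p\<in>?I. real (card (case p of (S, \<beta>) \<Rightarrow> Dv S \<beta>)))" by simp
  also have "\<dots> \<le> (\<Sum>p\<in>?I. 2 * 2 ^ r * exp (- (e\<^sup>2 * t / 4)))"
    by (intro sum_mono) (auto split: prod.splits intro!: dev)
  also have "\<dots> = real (card ?I) * (2 * 2 ^ r * exp (- (e\<^sup>2 * t / 4)))" by simp
  also have "\<dots> \<le> (2 * real r) ^ w * (2 * 2 ^ r * exp (- (e\<^sup>2 * t / 4)))"
    by (intro mult_right_mono cardI) auto
  finally show ?thesis by (simp add: mult_ac)
qed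

text \<open>The coordinates of \<open>y\<close> are exposed one at a time; the surviving part of \<open>A\<close> halves in each
  step while its density constant \<open>K\<close> and the ratio \<open>lam\<close> of its size to \<open>K\<close> hardly deteriorate.\<close>

lemma card_pattern_missed:
  fixes A :: "('u \<Rightarrow> nat) set" and P :: "'u set"
  assumes "finite J" "card J \<le> w" and r: "1 \<le> r" and t: "0 < t" and e: "0 < e" "e \<le> 1"
    and "finite A" "\<And>x v. x \<in> A \<Longrightarrow> v \<in> J \<Longrightarrow> x v < r" "0 < K"
    and "\<And>S \<beta>. S \<subseteq> J \<Longrightarrow> real (card {x\<in>A. \<forall>v\<in>S. x v = \<beta> v}) \<le> K * (1 / t) ^ card S"
    and "lam * K \<le> real (card A)" "lam \<le> 1" "2 * e * real (card J) < lam"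
  shows "real (card {y \<in> J \<rightarrow>\<^sub>E Pow {..<r}. \<forall>x\<in>A. \<exists>u\<in>J. (x u \<in> y u) \<noteq> (u \<in> P)})
    \<le> (2 ^ r) ^ card J * (real (card J) * (2 * (2 * real r) ^ w * exp (- (e\<^sup>2 * t / 4))))"
  using assms(1,2,7-)
proof (induction J arbitrary: A K lam rule: finite_induct)
  case empty
  \<comment> \<open>With all coordinates exposed, a single survivor realizes the pattern, and
    positivity of \<open>lam\<close> provides one.\<close>
  have "0 < lam * K" using empty by simp
  then have "0 < real (card A)" using empty.prems by linarith
  then have "A \<noteq> {}" by auto
  then have "{y \<in> {} \<rightarrow>\<^sub>E Pow {..<r}. \<forall>x\<in>A. \<exists>u\<in>{}. (x u \<in> y u) \<noteq> (u \<in> P)} = {}" by auto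
  then show ?case by (simp only:) simp
next
  case (insert u J)
  define E where "E = 2 * (2 * real r) ^ w * exp (- (e\<^sup>2 * t / 4))"
  have E0: "0 \<le> E" by (simp add: E_def)
  define Am where "Am = (\<lambda>Y. {x\<in>A. (x u \<in> Y) = (u \<in> P)})"
  define Fl where "Fl = (\<lambda>J A. {y \<in> J \<rightarrow>\<^sub>E Pow {..<r}. \<forall>x\<in>A. \<exists>u\<in>J. (x u \<in> y u) \<noteq> (u \<in> P)})"
  define good where "good = (\<lambda>Y. (\<forall>S \<beta>. S \<subseteq> J \<longrightarrow>
      real (card {x\<in>Am Y. \<forall>v\<in>S. x v = \<beta> v}) \<le> (K * (1 + e) / 2) * (1 / t) ^ card S) \<and>
      (lam - e) * K / 2 \<le> real (card (Am Y)))"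
  define B where "B = {Y \<in> Pow {..<r}. \<not> good Y}"
  define C where "C = Pow {..<r} - B"
  have cJ: "card J \<le> w" using insert by simp
  have lam: "2 * e * real (card J) < lam - 2 * e" using insert.prems insert.hyps by (simp add: algebra_simps)
  have bad: "real (card B) \<le> 2 ^ r * E"
    unfolding B_def good_def Am_def E_def
    by (rule card_step_bad) (use insert cJ r t e in auto)
  have finB: "finite B" "finite C" by (auto simp: B_def C_def)
  have finPiE: "finite (J \<rightarrow>\<^sub>E Pow {..<r})" using insert.hyps by (intro finite_PiE) auto
  have cardPiE: "card (J \<rightarrow>\<^sub>E Pow {..<r}) = (2 ^ r) ^ card J"
    using insert.hyps by (simp add: card_PiE card_Pow)
  have finFl: "finite (Fl J A')" for A' using finPiE by (simp add: Fl_def)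
  have step: "real (card (Fl J (Am Y))) \<le> (2 ^ r) ^ card J * (real (card J) * E)" if Y: "Y \<in> C" for Y
  proof -
    have g: "good Y" using Y by (simp add: B_def C_def)
    \<comment> \<open>The size is compared with the new constant \<open>K * (1 + e) / 2\<close>, not
      with \<open>K / 2\<close>. By \<open>lam \<le> 1\<close> this costs a second \<open>e\<close>,
      whence the loss of \<open>2 * e\<close> per coordinate in the hypothesis.\<close>
    have "(lam - 2 * e) * (1 + e) \<le> lam - e"
    proof -
      have "e * lam \<le> e" using insert.prems e by simp
      moreover have "0 \<le> e * (e * 2)" using e by simp
      moreover have "(lam - 2 * e) * (1 + e) = lam - 2 * e + e * lam - e * (e * 2)"
        by (simp add: algebra_simps)
      ultimately show ?thesis by linarith
    qed
    then have "(lam - 2 * e) * (1 + e) * (K / 2) \<le> (lam - e) * (K / 2)"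
      using insert.prems by (intro mult_right_mono) auto
    then have low: "(lam - 2 * e) * (K * (1 + e) / 2) \<le> real (card (Am Y))"
      using g unfolding good_def by (simp add: algebra_simps)
    show ?thesis
      unfolding Fl_def E_def
    proof (rule insert.IH[OF cJ])
      show "finite (Am Y)" using insert.prems by (simp add: Am_def)
      show "x v < r" if "x \<in> Am Y" "v \<in> J" for x v
        using that insert.prems by (simp add: Am_def)
      show "0 < K * (1 + e) / 2" using insert.prems e by simp
      show "real (card {x\<in>Am Y. \<forall>v\<in>S. x v = \<beta> v}) \<le> (K * (1 + e) / 2) * (1 / t) ^ card S"
        if "S \<subseteq> J" for S \<beta>
        using g that unfolding good_def by blast
      show "(lam - 2 * e) * (K * (1 + e) / 2) \<le> real (card (Am Y))" by (rule low)
      show "lam - 2 * e \<le> 1" using insert.prems e by simp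
      show "2 * e * real (card J) < lam - 2 * e" by (rule lam)
    qed
  qed
  \<comment> \<open>A failing \<open>y\<close> either begins with a bad \<open>Y\<close> and
    continues arbitrarily, or its remaining coordinates already fail for the survivors
    \<open>Am Y\<close>.\<close>
  have sub: "Fl (insert u J) A \<subseteq> (\<lambda>(Y, g). g(u := Y)) ` (B \<times> (J \<rightarrow>\<^sub>E Pow {..<r}) \<union> (SIGMA Y:C. Fl J (Am Y)))"
  proof
    fix y assume y: "y \<in> Fl (insert u J) A"
    then obtain Y g where Yg: "y = g(u := Y)" "Y \<in> Pow {..<r}" "g \<in> J \<rightarrow>\<^sub>E Pow {..<r}"
      by (auto simp: Fl_def PiE_insert_eq)
    have "g \<in> Fl J (Am Y)"
    proof -
      have "\<exists>v\<in>J. (x v \<in> g v) \<noteq> (v \<in> P)" if x: "x \<in> Am Y" for x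
      proof -
        have "x \<in> A" using x by (simp add: Am_def)
        then have "\<exists>v\<in>insert u J. (x v \<in> y v) \<noteq> (v \<in> P)" using y unfolding Fl_def by blast
        then obtain v where v: "v \<in> insert u J" "(x v \<in> y v) \<noteq> (v \<in> P)" by blast
        have "v \<noteq> u" using v x by (auto simp: Am_def Yg(1))
        then show ?thesis using v by (auto simp: Yg(1))
      qed
      then show ?thesis using Yg(3) by (simp add: Fl_def)
    qed
    then have "(Y, g) \<in> B \<times> (J \<rightarrow>\<^sub>E Pow {..<r}) \<union> (SIGMA Y:C. Fl J (Am Y))"
      using Yg by (auto simp: C_def)
    then show "y \<in> (\<lambda>(Y, g). g(u := Y)) ` (B \<times> (J \<rightarrow>\<^sub>E Pow {..<r}) \<union> (SIGMA Y:C. Fl J (Am Y)))"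
      using Yg(1) by (intro image_eqI[where x = "(Y, g)"]) auto
  qed
  have fin: "finite (B \<times> (J \<rightarrow>\<^sub>E Pow {..<r}) \<union> (SIGMA Y:C. Fl J (Am Y)))"
    using finB finPiE finFl by auto
  have "card (Fl (insert u J) A) \<le> card (B \<times> (J \<rightarrow>\<^sub>E Pow {..<r}) \<union> (SIGMA Y:C. Fl J (Am Y)))"
    by (rule order_trans[OF card_mono[OF finite_imageI[OF fin] sub] card_image_le[OF fin]])
  also have "\<dots> \<le> card (B \<times> (J \<rightarrow>\<^sub>E Pow {..<r})) + card (SIGMA Y:C. Fl J (Am Y))"
    by (rule card_Un_le)
  also have "card (SIGMA Y:C. Fl J (Am Y)) = (\<Sum>Y\<in>C. card (Fl J (Am Y)))"
    using finB finFl by (intro card_SigmaI) auto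
  finally have "real (card (Fl (insert u J) A))
      \<le> real (card (B \<times> (J \<rightarrow>\<^sub>E Pow {..<r})) + (\<Sum>Y\<in>C. card (Fl J (Am Y))))"
    by (rule of_nat_mono)
  also have "\<dots> = real (card B) * (2 ^ r) ^ card J + (\<Sum>Y\<in>C. real (card (Fl J (Am Y))))"
    by (simp add: card_cartesian_product cardPiE)
  also have "\<dots> \<le> 2 ^ r * E * (2 ^ r) ^ card J + 2 ^ r * ((2 ^ r) ^ card J * (real (card J) * E))"
  proof (rule add_mono)
    show "real (card B) * (2 ^ r) ^ card J \<le> 2 ^ r * E * (2 ^ r) ^ card J"
      using bad by (intro mult_right_mono) auto
    have "(\<Sum>Y\<in>C. real (card (Fl J (Am Y)))) \<le> (\<Sum>Y\<in>C. (2 ^ r) ^ card J * (real (card J) * E))"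
      by (intro sum_mono step)
    also have "\<dots> = real (card C) * ((2 ^ r) ^ card J * (real (card J) * E))" by simp
    also have "\<dots> \<le> 2 ^ r * ((2 ^ r) ^ card J * (real (card J) * E))"
    proof (rule mult_right_mono)
      have "card C \<le> card (Pow {..<r})" by (rule card_mono) (auto simp: C_def)
      then have "real (card C) \<le> real (2 ^ r)" unfolding card_Pow[OF finite_lessThan] card_lessThan by (rule of_nat_mono)
      then show "real (card C) \<le> 2 ^ r" by simp
      show "0 \<le> (2 ^ r) ^ card J * (real (card J) * E)" using E0 by simp
    qed
    finally show "(\<Sum>Y\<in>C. real (card (Fl J (Am Y)))) \<le> 2 ^ r * ((2 ^ r) ^ card J * (real (card J) * E))" .
  qed
  also have "\<dots> = (2 ^ r) ^ card (insert u J) * (real (card (insert u J)) * E)"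
    using insert.hyps by (simp add: algebra_simps)
  finally show ?case unfolding Fl_def E_def .
qed

text \<open>Density is restored by an extremal choice: among the patterns carrying at least a
  \<open>(1 / t) ^ card I\<close> fraction of \<open>A\<close>, one with the most coordinates is
  taken. A violation of density would extend it.\<close>

lemma dense_restriction:
  fixes A :: "('u \<Rightarrow> 'v) set" and t :: real
  assumes "finite U" "finite A" "A \<noteq> {}" "0 < t"
  obtains I \<alpha> where "I \<subseteq> U"
    "real (card A) * (1 / t) ^ card I \<le> real (card {x\<in>A. \<forall>v\<in>I. x v = \<alpha> v})"
    "\<And>S \<beta>. S \<subseteq> U - I \<Longrightarrow> real (card {x\<in>{x\<in>A. \<forall>v\<in>I. x v = \<alpha> v}. \<forall>v\<in>S. x v = \<beta> v})
      \<le> real (card {x\<in>A. \<forall>v\<in>I. x v = \<alpha> v}) * (1 / t) ^ card S"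
proof -
  define popular where "popular = (\<lambda>(I, \<alpha>). I \<subseteq> U \<and>
    real (card A) * (1 / t) ^ card I \<le> real (card {x\<in>A. \<forall>v\<in>I. x v = \<alpha> v}))"
  have "popular ({}, undefined)" by (simp add: popular_def)
  moreover have "\<forall>p. popular p \<longrightarrow> card (fst p) < Suc (card U)"
    using assms by (auto simp: popular_def less_Suc_eq_le intro: card_mono)
  ultimately have "\<exists>p. popular p \<and> (\<forall>q. popular q \<longrightarrow> card (fst q) \<le> card (fst p))"
    by (rule Lattices_Big.ex_has_greatest_nat)
  then obtain p where p: "popular p" "\<And>q. popular q \<Longrightarrow> card (fst q) \<le> card (fst p)" by blast
  obtain I \<alpha> where "p = (I, \<alpha>)" by (cases p)
  then have I: "popular (I, \<alpha>)" and greatest: "\<And>J \<beta>. popular (J, \<beta>) \<Longrightarrow> card J \<le> card I"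
    using p by force+
  let ?A = "{x\<in>A. \<forall>v\<in>I. x v = \<alpha> v}"
  have "real (card {x\<in>?A. \<forall>v\<in>S. x v = \<beta> v}) \<le> real (card ?A) * (1 / t) ^ card S"
    if S: "S \<subseteq> U - I" for S \<beta>
  proof (rule ccontr)
    assume less: "\<not> real (card {x\<in>?A. \<forall>v\<in>S. x v = \<beta> v}) \<le> real (card ?A) * (1 / t) ^ card S"
    define \<gamma> where "\<gamma> = (\<lambda>v. if v \<in> I then \<alpha> v else \<beta> v)"
    have fin: "finite I" "finite S" using I S assms finite_subset by (auto simp: popular_def)
    have "S \<noteq> {}" using less by auto
    then have card: "card (I \<union> S) = card I + card S" "0 < card S"
      using fin S by (auto intro!: card_Un_disjoint)
    have "real (card A) * (1 / t) ^ card (I \<union> S) = real (card A) * (1 / t) ^ card I * (1 / t) ^ card S"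
      by (simp add: card power_add)
    also have "\<dots> \<le> real (card ?A) * (1 / t) ^ card S"
      using I assms by (intro mult_right_mono) (auto simp: popular_def)
    also have "\<dots> \<le> real (card {x\<in>?A. \<forall>v\<in>S. x v = \<beta> v})" using less by simp
    also have "{x\<in>?A. \<forall>v\<in>S. x v = \<beta> v} = {x\<in>A. \<forall>v\<in>I \<union> S. x v = \<gamma> v}"
      using S by (auto simp: \<gamma>_def)
    finally have "popular (I \<union> S, \<gamma>)" using I S by (auto simp: popular_def)
    then have "card (I \<union> S) \<le> card I" by (rule greatest)
    then show False using card by simp
  qed
  moreover have "I \<subseteq> U" "real (card A) * (1 / t) ^ card I \<le> real (card ?A)"
    using I by (simp_all add: popular_def)
  ultimately show ?thesis by (intro that)
qed

lemma popular_value: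
  assumes fin: "finite A" "finite C" and C: "C \<noteq> {}" and f: "f ` A \<subseteq> C"
  obtains c where "c \<in> C" "card A \<le> card {a\<in>A. f a = c} * card C"
proof -
  let ?n = "\<lambda>c. card {a\<in>A. f a = c}"
  have "Max (?n ` C) \<in> ?n ` C" using fin C by (intro Max_in) auto
  then obtain c where c: "c \<in> C" "?n c = Max (?n ` C)" by auto
  have "card A = card (\<Union>c\<in>C. {a\<in>A. f a = c})" using f by (intro arg_cong[where f = card]) auto
  also have "\<dots> \<le> (\<Sum>c\<in>C. ?n c)" by (rule card_UN_le[OF fin(2)])
  also have "\<dots> \<le> (\<Sum>_\<in>C. ?n c)" unfolding c(2) using fin by (intro sum_mono Max_ge) auto
  finally show ?thesis using c that by (simp add: mult.commute)
qed

section \<open>Lifting\<close>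

text \<open>The two halves of a point are the inputs of the two players in a communication problem: \<open>x\<close>
  addresses into the bit strings encoded by the sets \<open>y u\<close>. A point decodes to the all-zero
  assignment.\<close>

definition lifted_points :: "'u set \<Rightarrow> nat \<Rightarrow> (('u \<Rightarrow> nat) \<times> ('u \<Rightarrow> nat set)) set" where
  "lifted_points U r = {(x, y). x \<in> U \<rightarrow>\<^sub>E {..<r} \<and> y \<in> U \<rightarrow>\<^sub>E Pow {..<r} \<and> (\<forall>u\<in>U. x u \<notin> y u)}"

lemma finite_lifted_points:
  assumes "finite U"
  shows "finite (lifted_points U r)" and "card (lifted_points U r) \<le> r ^ card U * (2 ^ r) ^ card U"
proof -
  have sub: "lifted_points U r \<subseteq> (U \<rightarrow>\<^sub>E {..<r}) \<times> (U \<rightarrow>\<^sub>E Pow {..<r})"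
    by (auto simp: lifted_points_def)
  have fin: "finite ((U \<rightarrow>\<^sub>E {..<r}) \<times> (U \<rightarrow>\<^sub>E Pow {..<r}))"
    using assms by (intro finite_cartesian_product finite_PiE) auto
  show "finite (lifted_points U r)" using sub fin by (rule finite_subset)
  show "card (lifted_points U r) \<le> r ^ card U * (2 ^ r) ^ card U"
    using card_mono[OF fin sub] assms by (simp add: card_cartesian_product card_PiE card_Pow)
qed

lemma card_PiE_restrict_le:
  fixes M :: "('u \<Rightarrow> 'v) set"
  assumes "finite U" "J \<subseteq> U" "finite B" "M \<subseteq> U \<rightarrow>\<^sub>E B" "finite F" "\<And>y. y \<in> M \<Longrightarrow> restrict y J \<in> F"
  shows "card M \<le> card F * card B ^ (card U - card J)"
proof -
  have fin: "finite (F \<times> (U - J \<rightarrow>\<^sub>E B))"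
    using assms by (intro finite_cartesian_product finite_PiE) auto
  have "inj_on (\<lambda>y. (restrict y J, restrict y (U - J))) M"
  proof (rule inj_onI)
    fix y z assume yz: "y \<in> M" "z \<in> M"
      and eq: "(restrict y J, restrict y (U - J)) = (restrict z J, restrict z (U - J))"
    show "y = z"
    proof (rule PiE_ext)
      show "y \<in> U \<rightarrow>\<^sub>E B" "z \<in> U \<rightarrow>\<^sub>E B" using yz assms by auto
      fix u assume "u \<in> U"
      then show "y u = z u"
        using eq by (cases "u \<in> J") (auto dest: fun_cong[of _ _ u])
    qed
  qed
  moreover have "(\<lambda>y. (restrict y J, restrict y (U - J))) ` M \<subseteq> F \<times> (U - J \<rightarrow>\<^sub>E B)"
    using assms by (auto simp: PiE_iff subset_iff)
  ultimately have "card M \<le> card (F \<times> (U - J \<rightarrow>\<^sub>E B))" using fin by (rule card_inj_on_le)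
  also have "\<dots> = card F * card B ^ (card U - card J)"
    using assms by (simp add: card_cartesian_product card_PiE card_Diff_subset finite_subset)
  finally show ?thesis .
qed

text \<open>A colouring with at most \<open>r ^ c\<close> colours is not proper. Taking popular
  colours twice gives many \<open>x\<close> with one popular colour \<open>c0\<close>; after a dense
  restriction, a term avoiding the fixed coordinates is realized against almost every
  \<open>y\<close>, hence against some \<open>y'\<close> of colour \<open>c0\<close>.\<close>

lemma monochromatic_separated_pair:
  fixes \<kappa> :: "('u \<Rightarrow> nat) \<times> ('u \<Rightarrow> nat set) \<Rightarrow> 'c" and TT :: "('u set \<times> 'u set) set"
  assumes U: "finite U" and t: "2 \<le> t" and r: "r = t ^ 2" and w: "1 \<le> w"
    and TT: "\<And>P Q. (P, Q) \<in> TT \<Longrightarrow> P \<union> Q \<subseteq> U \<and> P \<inter> Q = {} \<and> card (P \<union> Q) \<le> w"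
    and avoid: "\<And>I. I \<subseteq> U \<Longrightarrow> card I \<le> 2 * c \<Longrightarrow> \<exists>(P, Q)\<in>TT. P \<inter> I = {}"
    and num: "real w * (2 * (2 * real r) ^ w * exp (- ((1 / (4 * real w))\<^sup>2 * real t / 4)))
      * 2 ^ card U * real r ^ c < 1"
    and colors: "card (\<kappa> ` lifted_points U r) \<le> r ^ c"
  shows "\<exists>(P, Q)\<in>TT. \<exists>(x, y)\<in>lifted_points U r. \<exists>(x', y')\<in>lifted_points U r.
    \<kappa> (x, y) = \<kappa> (x', y') \<and> (\<forall>u\<in>P \<union> Q. x u \<in> y' u \<longleftrightarrow> u \<in> P)"
proof -
  define X where "X = U \<rightarrow>\<^sub>E {..<r}"
  define Fib where "Fib = (\<lambda>x. \<Pi>\<^sub>E u\<in>U. Pow ({..<r} - {x u}))"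
  define C where "C = \<kappa> ` lifted_points U r"
  have r1: "1 \<le> r" using t r by simp
  have t0: "0 < real t" using t by simp
  have finX: "finite X" using U by (simp add: X_def finite_PiE)
  have cardX: "card X = r ^ card U" using U by (simp add: X_def card_PiE)
  have finC: "finite C" using finite_lifted_points[OF U] by (simp add: C_def)
  have finFib: "finite (Fib x)" for x using U by (simp add: Fib_def finite_PiE)
  have cardFib: "card (Fib x) = (2 ^ (r - 1)) ^ card U" if "x \<in> X" for x
  proof -
    have "card (Fib x) = (\<Prod>u\<in>U. 2 ^ (r - 1))"
      unfolding Fib_def card_PiE[OF U]
      using that by (intro prod.cong) (auto simp: X_def card_Pow card_Diff_singleton PiE_iff)
    then show ?thesis by simp
  qed
  have pt: "(x, y) \<in> lifted_points U r \<longleftrightarrow> x \<in> X \<and> y \<in> Fib x" for x y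
    by (fastforce simp: lifted_points_def X_def Fib_def PiE_iff)
  have "\<exists>col. col \<in> C \<and> card (Fib x) \<le> card {y\<in>Fib x. \<kappa> (x, y) = col} * card C" if x: "x \<in> X" for x
  proof -
    have "0 < card (Fib x)" by (simp add: cardFib[OF x])
    then obtain y where "y \<in> Fib x" by fastforce
    then have "\<kappa> (x, y) \<in> C" using pt x unfolding C_def by blast
    then have C0: "C \<noteq> {}" by blast
    have sub: "(\<lambda>y. \<kappa> (x, y)) ` Fib x \<subseteq> C" using pt x unfolding C_def by blast
    obtain col where "col \<in> C" "card (Fib x) \<le> card {y\<in>Fib x. \<kappa> (x, y) = col} * card C"
      by (rule popular_value[OF finFib finC C0 sub])
    then show ?thesis by blast
  qed
  note ex_col = this
  define col where "col = (\<lambda>x. SOME col. col \<in> C \<and>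
    card (Fib x) \<le> card {y\<in>Fib x. \<kappa> (x, y) = col} * card C)"
  have col: "col x \<in> C" "card (Fib x) \<le> card {y\<in>Fib x. \<kappa> (x, y) = col x} * card C" if "x \<in> X" for x
    using someI_ex[OF ex_col[OF that]] unfolding col_def by blast+
  have X0: "X \<noteq> {}" using cardX r1 by auto
  then have C0: "C \<noteq> {}" using col(1) by auto
  have "col ` X \<subseteq> C" using col(1) by blast
  then obtain c0 where "c0 \<in> C" and c0: "card X \<le> card {x\<in>X. col x = c0} * card C"
    by (rule popular_value[OF finX finC C0])
  define A where "A = {x\<in>X. col x = c0}"
  have finA: "finite A" using finX by (simp add: A_def)
  have cardA: "r ^ card U \<le> card A * r ^ c"
    using c0 mult_le_mono2[OF colors, of "card A"] unfolding A_def C_def cardX[symmetric]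
    by (rule order_trans)
  then have A0: "A \<noteq> {}" using r1 by auto
  obtain I \<alpha> where I: "I \<subseteq> U"
    and size: "real (card A) * (1 / real t) ^ card I \<le> real (card {x\<in>A. \<forall>v\<in>I. x v = \<alpha> v})"
    and dense: "\<And>S \<beta>. S \<subseteq> U - I \<Longrightarrow> real (card {x\<in>{x\<in>A. \<forall>v\<in>I. x v = \<alpha> v}. \<forall>v\<in>S. x v = \<beta> v})
      \<le> real (card {x\<in>A. \<forall>v\<in>I. x v = \<alpha> v}) * (1 / real t) ^ card S"
    by (rule dense_restriction[OF U finA A0 t0]) (rule that)
  define A' where "A' = {x\<in>A. \<forall>v\<in>I. x v = \<alpha> v}"
  have A'X: "A' \<subseteq> X" by (auto simp: A'_def A_def)
  have finA': "finite A'" using finA by (simp add: A'_def)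
  have "0 < real (card A) * (1 / real t) ^ card I" using finA A0 t by (simp add: card_gt_0_iff)
  then have cardA': "0 < real (card A')" using size by (simp add: A'_def)
  have finI: "finite I" using I U finite_subset by blast
  \<comment> \<open>Fixing \<open>I\<close> costs a factor \<open>r\<close> per coordinate in the
    number of inputs but lowers the guaranteed size only by \<open>t\<close>. As
    \<open>r = t ^ 2\<close>, each fixed coordinate gains a factor \<open>t\<close>, and the initial
    deficit \<open>r ^ c\<close> is \<open>t ^ (2 * c)\<close>.\<close>
  have cardI: "card I \<le> 2 * c"
  proof -
    have "card A' \<le> card {restrict \<alpha> I} * card {..<r} ^ (card U - card I)"
      by (rule card_PiE_restrict_le) (use U I A'X in \<open>auto simp: X_def A'_def\<close>)
    then have "card A' \<le> r ^ (card U - card I)" by simp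
    then have "real (card A') \<le> real (r ^ (card U - card I))" by (rule of_nat_mono)
    then have "real (card A) * (1 / real t) ^ card I \<le> real r ^ (card U - card I)"
      using size unfolding A'_def of_nat_power by linarith
    then have *: "real (card A) \<le> real r ^ (card U - card I) * real t ^ card I"
      using t0 by (simp add: power_divide field_simps)
    have "real (r ^ card U) \<le> real (card A * r ^ c)" using cardA by (rule of_nat_mono)
    also have "\<dots> \<le> real r ^ (card U - card I) * real t ^ card I * real r ^ c"
      using * by (simp add: mult_right_mono)
    finally have "real t ^ (2 * card U) \<le> real t ^ (2 * (card U - card I) + card I + 2 * c)"
      by (simp add: r power_add power_mult)
    then have "2 * card U \<le> 2 * (card U - card I) + card I + 2 * c"
      using t by (subst (asm) power_increasing_iff) auto
    then show ?thesis using card_mono[OF U I] by linarith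
  qed
  from avoid[OF I cardI] obtain P Q where PQ: "(P, Q) \<in> TT" "P \<inter> I = {}" by blast
  note TT' = TT[OF PQ(1)]
  define J where "J = (P \<union> Q) - I"
  have J: "J \<subseteq> U" "J \<subseteq> U - I" "finite J" using TT' U finite_subset by (auto simp: J_def)
  have Jw: "card J \<le> w"
  proof -
    have "finite (P \<union> Q)" using TT' U finite_subset by blast
    then have "card J \<le> card (P \<union> Q)" unfolding J_def by (intro card_mono) auto
    then show ?thesis using TT' by simp
  qed
  define F where "F = {y \<in> J \<rightarrow>\<^sub>E Pow {..<r}. \<forall>x\<in>A'. \<exists>u\<in>J. (x u \<in> y u) \<noteq> (u \<in> P)}"
  define M where "M = {y \<in> U \<rightarrow>\<^sub>E Pow {..<r}. \<forall>x\<in>A'. \<exists>u\<in>J. (x u \<in> y u) \<noteq> (u \<in> P)}"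
  define E where "E = 2 * (2 * real r) ^ w * exp (- ((1 / (4 * real w))\<^sup>2 * real t / 4))"
  have E0: "0 \<le> E" by (simp add: E_def)
  have finF: "finite F" using J by (simp add: F_def finite_PiE)
  have "real (card F) \<le> (2 ^ r) ^ card J * (real (card J) * E)"
    unfolding F_def E_def
  \<comment> \<open>With \<open>lam = 1\<close> and \<open>e = 1 / (4 * w)\<close>, at most half of
    \<open>lam\<close> is consumed by the at most \<open>w\<close> coordinates.\<close>
  proof (rule card_pattern_missed[where K = "real (card A')" and lam = 1])
    show "x v < r" if "x \<in> A'" "v \<in> J" for x v
      using that A'X J by (auto simp: X_def PiE_iff)
    show "real (card {x\<in>A'. \<forall>v\<in>S. x v = \<beta> v}) \<le> real (card A') * (1 / real t) ^ card S"
      if "S \<subseteq> J" for S \<beta>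
      unfolding A'_def using that J by (intro dense) blast
    have "real (card J) \<le> real w" using Jw by simp
    then show "2 * (1 / (4 * real w)) * real (card J) < 1" using w by (simp add: field_simps)
  qed (use J Jw r1 t0 w finA' cardA' in auto)
  moreover have "card M \<le> card F * card (Pow {..<r}) ^ (card U - card J)"
  proof (rule card_PiE_restrict_le[OF U J(1) _ _ finF])
    show "M \<subseteq> U \<rightarrow>\<^sub>E Pow {..<r}" unfolding M_def by blast
    show "restrict y J \<in> F" if "y \<in> M" for y
      using that J(1) unfolding M_def F_def by (auto simp: PiE_iff subset_iff)
  qed simp
  then have "real (card M) \<le> real (card F * card (Pow {..<r}) ^ (card U - card J))"
    by (rule of_nat_mono)
  then have "real (card M) \<le> real (card F) * (2 ^ r) ^ (card U - card J)"
    by (simp add: card_Pow)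
  ultimately have "real (card M) \<le> (2 ^ r) ^ card J * (real (card J) * E) * (2 ^ r) ^ (card U - card J)"
    by (meson mult_right_mono order_trans zero_le_numeral zero_le_power)
  also have "\<dots> = (2 ^ r) ^ (card J + (card U - card J)) * (real (card J) * E)"
    by (simp only: power_add mult_ac)
  also have "card J + (card U - card J) = card U" using card_mono[OF U J(1)] by simp
  also have "(2 ^ r) ^ card U * (real (card J) * E) \<le> (2 ^ r) ^ card U * (real w * E)"
    using Jw E0 by (intro mult_left_mono mult_right_mono) auto
  finally have cardM: "real (card M) \<le> (2 ^ r) ^ card U * (real w * E)" .
  obtain x0 where x0: "x0 \<in> A'" using cardA' by fastforce
  have x0X: "x0 \<in> X" using x0 A'X by blast
  define Y0 where "Y0 = {y\<in>Fib x0. \<kappa> (x0, y) = c0}"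
  have "\<not> Y0 \<subseteq> M"
  proof
    assume "Y0 \<subseteq> M"
    moreover have "finite M" using U by (simp add: M_def finite_PiE)
    ultimately have "card Y0 \<le> card M" by (rule card_mono[rotated])
    then have "real (card Y0) \<le> (2 ^ r) ^ card U * (real w * E)" using cardM by linarith
    moreover have "card (Fib x0) \<le> card Y0 * card C"
      using col(2)[OF x0X] x0 by (simp add: Y0_def A'_def A_def)
    then have "card (Fib x0) \<le> card Y0 * r ^ c" using colors by (metis C_def mult_le_mono2 order_trans)
    then have "real (card (Fib x0)) \<le> real (card Y0 * r ^ c)" by (rule of_nat_mono)
    then have "(2 ^ (r - 1)) ^ card U \<le> real (card Y0) * real r ^ c" by (simp add: cardFib[OF x0X])
    ultimately have "(2 ^ (r - 1)) ^ card U \<le> (2 ^ r) ^ card U * (real w * E) * real r ^ c"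
      by (meson mult_right_mono of_nat_0_le_iff order_trans zero_le_power)
    \<comment> \<open>The sets in a fibre omit \<open>x0 u\<close>, so a fibre is smaller than the
      full product by the factor \<open>2 ^ card U\<close>; the popular colour loses another
      \<open>r ^ c\<close>. Both factors appear in \<open>num\<close>.\<close>
    also have "(2 ^ r :: real) = 2 ^ (r - 1) * 2" using r1 by (metis Suc_diff_1 less_le_trans power_Suc2 zero_less_one)
    finally have "(2 ^ (r - 1)) ^ card U * 1 \<le> (2 ^ (r - 1)) ^ card U * (real w * E * 2 ^ card U * real r ^ c)"
      by (simp add: power_mult_distrib mult_ac)
    then have "1 \<le> real w * E * 2 ^ card U * real r ^ c" by simp
    then show False using num by (simp add: E_def)
  qed
  then obtain y' where y': "y' \<in> Fib x0" "\<kappa> (x0, y') = c0" "y' \<notin> M" by (auto simp: Y0_def)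
  have pt0: "(x0, y') \<in> lifted_points U r" using pt x0X y' by simp
  then have "y' \<in> U \<rightarrow>\<^sub>E Pow {..<r}" by (simp add: lifted_points_def)
  then obtain x where x: "x \<in> A'" "\<forall>u\<in>J. x u \<in> y' u \<longleftrightarrow> u \<in> P" using y'(3) by (auto simp: M_def)
  \<comment> \<open>On \<open>I\<close> all survivors use the address of \<open>x0\<close>, where
    \<open>y'\<close> reads 0. This satisfies the negative literals, and no positive literal lies in
    \<open>I\<close>.\<close>
  have sat: "x u \<in> y' u \<longleftrightarrow> u \<in> P" if u: "u \<in> P \<union> Q" for u
  proof (cases "u \<in> I")
    case True
    then have "x u = x0 u" using x x0 by (simp add: A'_def)
    moreover have "x0 u \<notin> y' u" using pt0 True I by (auto simp: lifted_points_def)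
    moreover have "u \<notin> P" using True PQ by blast
    ultimately show ?thesis by simp
  next
    case False
    then show ?thesis using x u by (simp add: J_def)
  qed
  have xX: "x \<in> X" "col x = c0" using x(1) by (auto simp: A'_def A_def)
  \<comment> \<open>The other point needs only some partner of the same colour, which exists because
    \<open>c0\<close> is popular on the fibre of \<open>x\<close>.\<close>
  have "\<exists>y\<in>Fib x. \<kappa> (x, y) = c0"
  proof -
    have "0 < card (Fib x)" by (simp add: cardFib[OF xX(1)])
    also have "card (Fib x) \<le> card {y\<in>Fib x. \<kappa> (x, y) = c0} * card C"
      using col(2)[OF xX(1)] unfolding xX(2) .
    finally have "{y\<in>Fib x. \<kappa> (x, y) = c0} \<noteq> {}" by (intro notI) simp
    then show ?thesis by blast
  qed
  then obtain y where y: "y \<in> Fib x" "\<kappa> (x, y) = c0" by blast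
  have xy: "(x, y) \<in> lifted_points U r" using pt xX(1) y(1) by blast
  show ?thesis
    by (rule bexI[OF _ PQ(1)], unfold prod.case, rule bexI[OF _ xy], unfold prod.case,
        rule bexI[OF _ pt0], unfold prod.case) (use sat y y'(2) in simp)
qed

section \<open>Certificates\<close>

text \<open>A partial assignment is a pair \<open>(P, Q)\<close> of the sets of variables set to 1 and to 0.\<close>

definition conflict :: "'u set \<times> 'u set \<Rightarrow> 'u set \<times> 'u set \<Rightarrow> bool" where
  "conflict c c' \<longleftrightarrow> fst c \<inter> snd c' \<noteq> {} \<or> fst c' \<inter> snd c \<noteq> {}"

section \<open>Hitting sets for families with small intersections\<close>

text \<open>Double counting of incidences finds a point lying in at least a \<open>d\<close>
  fraction of the sets not yet hit.\<close>

lemma greedy_hitting_set: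
  fixes F :: "'i \<Rightarrow> 'w set"
  assumes "finite L" "finite V" "V \<noteq> {}" and d: "d \<le> 1"
    and F: "\<And>i. i \<in> L \<Longrightarrow> F i \<subseteq> V" "\<And>i. i \<in> L \<Longrightarrow> d * real (card V) \<le> real (card (F i))"
  shows "\<exists>P\<subseteq>V. card P \<le> p \<and> real (card {i\<in>L. F i \<inter> P = {}}) \<le> real (card L) * (1 - d) ^ p"
proof (induction p)
  case 0
  show ?case by (intro exI[of _ "{}"]) simp
next
  case (Suc p)
  then obtain P where P: "P \<subseteq> V" "card P \<le> p"
    "real (card {i\<in>L. F i \<inter> P = {}}) \<le> real (card L) * (1 - d) ^ p" by blast
  define R where "R = {i\<in>L. F i \<inter> P = {}}"
  have finR: "finite R" using assms by (simp add: R_def)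
  have "\<exists>v\<in>V. d * real (card R) \<le> real (card {i\<in>R. v \<in> F i})"
  proof (rule ccontr)
    assume "\<not> ?thesis"
    then have "(\<Sum>v\<in>V. real (card {i\<in>R. v \<in> F i})) < (\<Sum>v\<in>V. d * real (card R))"
      using assms by (intro sum_strict_mono) auto
    moreover have "(\<Sum>v\<in>V. card {i\<in>R. v \<in> F i}) = (\<Sum>i\<in>R. card {v\<in>V. v \<in> F i})"
      using assms finR by (intro sum_multicount_gen) auto
    then have "(\<Sum>v\<in>V. real (card {i\<in>R. v \<in> F i})) = (\<Sum>i\<in>R. real (card {v\<in>V. v \<in> F i}))"
      by (metis (mono_tags, lifting) of_nat_sum sum.cong)
    moreover have "(\<Sum>i\<in>R. d * real (card V)) \<le> (\<Sum>i\<in>R. real (card {v\<in>V. v \<in> F i}))"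
    proof (rule sum_mono)
      fix i assume i: "i \<in> R"
      then have "{v\<in>V. v \<in> F i} = F i" using F(1)[of i] by (auto simp: R_def)
      then show "d * real (card V) \<le> real (card {v\<in>V. v \<in> F i})" using F(2) i by (simp add: R_def)
    qed
    ultimately show False by (simp add: mult_ac)
  qed
  then obtain v where v: "v \<in> V" "d * real (card R) \<le> real (card {i\<in>R. v \<in> F i})" by blast
  have eq: "{i\<in>L. F i \<inter> insert v P = {}} = R - {i\<in>R. v \<in> F i}" by (auto simp: R_def)
  have "card (R - {i\<in>R. v \<in> F i}) + card {i\<in>R. v \<in> F i} = card R"
    using finR card_mono[of R "{i\<in>R. v \<in> F i}"] by (subst card_Diff_subset) auto
  then have "real (card (R - {i\<in>R. v \<in> F i})) \<le> real (card R) * (1 - d)"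
    using v(2) by (simp add: algebra_simps flip: of_nat_add)
  also have "\<dots> \<le> real (card L) * (1 - d) ^ p * (1 - d)"
    using P(3) d by (intro mult_right_mono) (auto simp: R_def)
  finally have "real (card {i\<in>L. F i \<inter> insert v P = {}}) \<le> real (card L) * (1 - d) ^ Suc p"
    by (simp only: eq power_Suc2 mult.assoc)
  moreover have "card (insert v P) \<le> Suc p" using P(2) card_insert_le_m1[of "Suc p" P v] by simp
  ultimately show ?case using v(1) P(1) by (intro exI[of _ "insert v P"]) auto
qed

text \<open>Each further set overlaps the union of the earlier ones in at most one point per earlier
  set.\<close>

lemma sum_card_le_card_Union:
  fixes M :: "'i \<Rightarrow> 'w set"
  assumes "finite H" "\<And>i. i \<in> H \<Longrightarrow> finite (M i)"
    "\<And>i j. i \<in> H \<Longrightarrow> j \<in> H \<Longrightarrow> i \<noteq> j \<Longrightarrow> card (M i \<inter> M j) \<le> 1"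
  shows "(\<Sum>i\<in>H. card (M i)) \<le> card (\<Union>i\<in>H. M i) + (card H)\<^sup>2"
  using assms
proof (induction H rule: finite_induct)
  case (insert h H)
  have fin: "finite (M h)" "finite (\<Union>i\<in>H. M i)" using insert by auto
  have "card (M h \<inter> (\<Union>i\<in>H. M i)) = card (\<Union>i\<in>H. M h \<inter> M i)" by (rule arg_cong[where f = card]) auto
  also have "\<dots> \<le> (\<Sum>i\<in>H. card (M h \<inter> M i))" by (rule card_UN_le[OF insert.hyps(1)])
  also have "\<dots> \<le> (\<Sum>i\<in>H. 1)" using insert.hyps by (intro sum_mono insert.prems(2)) auto
  finally have "card (M h \<inter> (\<Union>i\<in>H. M i)) \<le> card H" by simp
  moreover have "card (M h) + card (\<Union>i\<in>H. M i) =
      card (M h \<union> (\<Union>i\<in>H. M i)) + card (M h \<inter> (\<Union>i\<in>H. M i))"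
    by (rule card_Un_Int[OF fin])
  moreover have "(\<Sum>i\<in>H. card (M i)) \<le> card (\<Union>i\<in>H. M i) + (card H)\<^sup>2"
    using insert by simp
  ultimately show ?case using insert.hyps by (simp add: power2_eq_square)
qed simp

text \<open>By Bonferroni, fewer than \<open>h\<close> of the sets \<open>Nb i\<close> have more than half of their elements in \<open>I\<close>;
  a greedy choice hits the others outside \<open>I\<close>.\<close>

lemma hitting_set_avoiding:
  fixes Nb :: "'i \<Rightarrow> 'w set"
  assumes fin: "finite L" "finite W" and W: "W \<noteq> {}"
    and Nb: "\<And>i. i \<in> L \<Longrightarrow> Nb i \<subseteq> W" "\<And>i. i \<in> L \<Longrightarrow> card (Nb i) = g"
      "\<And>i j. i \<in> L \<Longrightarrow> j \<in> L \<Longrightarrow> i \<noteq> j \<Longrightarrow> card (Nb i \<inter> Nb j) \<le> 1"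
    and I: "finite I" "2 * (card I + h\<^sup>2) < h * g"
    and g: "g \<le> card W" and p: "real (card L) * (1 - real g / (2 * real (card W))) ^ p < 1"
  shows "\<exists>P\<subseteq>W - I. card P \<le> p \<and> card {i\<in>L. Nb i \<inter> P = {}} < h"
proof -
  define H where "H = {i\<in>L. 2 * card (Nb i - I) < g}"
  have finNb: "finite (Nb i)" if "i \<in> L" for i using Nb(1)[OF that] fin finite_subset by blast
  have cardH: "card H < h"
  proof (rule ccontr)
    assume "\<not> card H < h"
    then obtain T where T: "T \<subseteq> H" "card T = h" "finite T"
      by (metis not_less obtain_subset_with_card_n)
    have TL: "T \<subseteq> L" using T by (auto simp: H_def)
    have "h * g = (\<Sum>i\<in>T. g)" using T by simp
    also have "\<dots> \<le> (\<Sum>i\<in>T. 2 * card (Nb i \<inter> I))"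
    proof (rule sum_mono)
      fix i assume i: "i \<in> T"
      then have "2 * card (Nb i - I) < g" "i \<in> L" using T by (auto simp: H_def)
      moreover have "card (Nb i) = card (Nb i \<inter> I) + card (Nb i - I)"
        using finNb[OF \<open>i \<in> L\<close>] by (metis card_Int_Diff)
      ultimately show "g \<le> 2 * card (Nb i \<inter> I)" using Nb(2)[of i] by simp
    qed
    also have "\<dots> = 2 * (\<Sum>i\<in>T. card (Nb i \<inter> I))" by (simp add: sum_distrib_left)
    also have "\<dots> \<le> 2 * (card (\<Union>i\<in>T. Nb i \<inter> I) + (card T)\<^sup>2)"
    proof (intro mult_left_mono sum_card_le_card_Union)
      fix i j assume ij: "i \<in> T" "j \<in> T" "i \<noteq> j"
      have "card ((Nb i \<inter> I) \<inter> (Nb j \<inter> I)) \<le> card (Nb i \<inter> Nb j)"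
        using ij TL finNb by (intro card_mono) auto
      then show "card ((Nb i \<inter> I) \<inter> (Nb j \<inter> I)) \<le> 1" using Nb(3)[of i j] ij TL by force
    qed (use T I in auto)
    also have "\<dots> \<le> 2 * (card I + h\<^sup>2)"
      using I T by (intro mult_left_mono add_mono card_mono) auto
    finally show False using I by simp
  qed
  \<comment> \<open>Outside \<open>H\<close>, at least half of the \<open>g\<close> elements of
    \<open>Nb i\<close> survive the removal of \<open>I\<close>; this is their density in
    \<open>W\<close>.\<close>
  define d where "d = real g / (2 * real (card W))"
  have W0: "0 < real (card W)" using fin W by (simp add: card_gt_0_iff)
  have "d * real (card W) = real g / 2" using W0 by (simp add: d_def)
  moreover have "real g / (2 * real (card W)) \<le> 1 / 2" using g W0 by (simp add: divide_le_eq)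
  then have "d \<le> 1" by (simp add: d_def)
  ultimately have "\<exists>P\<subseteq>W. card P \<le> p \<and>
      real (card {i\<in>L - H. (Nb i - I) \<inter> P = {}}) \<le> real (card (L - H)) * (1 - d) ^ p"
    using fin W Nb(1) by (intro greedy_hitting_set) (auto simp: H_def)
  then obtain P where P: "P \<subseteq> W" "card P \<le> p"
    "real (card {i\<in>L - H. (Nb i - I) \<inter> P = {}}) \<le> real (card (L - H)) * (1 - d) ^ p" by blast
  note P(3)
  also have "real (card (L - H)) * (1 - d) ^ p \<le> real (card L) * (1 - d) ^ p"
    using fin \<open>d \<le> 1\<close> by (intro mult_right_mono of_nat_mono card_mono) auto
  also have "\<dots> < 1" using p by (simp add: d_def)
  finally have "card {i\<in>L - H. (Nb i - I) \<inter> P = {}} = 0" by simp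
  then have "{i\<in>L - H. (Nb i - I) \<inter> P = {}} = {}" using fin by simp
  \<comment> \<open>The greedy choice was made for the sets \<open>Nb i - I\<close>, so discarding
    the elements of \<open>I\<close> from \<open>P\<close> spoils no hit.\<close>
  then have "{i\<in>L. Nb i \<inter> (P - I) = {}} \<subseteq> H" by blast
  moreover have "finite H" using fin by (simp add: H_def)
  ultimately have "card {i\<in>L. Nb i \<inter> (P - I) = {}} < h" using cardH card_mono le_less_trans by metis
  moreover have "card (P - I) \<le> p"
    using P fin finite_subset[OF P(1)] by (meson Diff_subset card_mono order_trans)
  ultimately show ?thesis using P(1) by (intro exI[of _ "P - I"]) auto
qed

section \<open>Lines in an integer grid and their certificates\<close>

text \<open>Lines over the integers, as in Elekes's configuration: small slopes and intercepts keep
  them inside a grid, so powers of 2 can be used as side lengths.\<close>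

definition line_pts :: "nat \<Rightarrow> nat \<times> nat \<Rightarrow> (nat \<times> nat) set" where
  "line_pts n ab = (\<lambda>x. (x, fst ab * x + snd ab)) ` {..<n}"

lemma card_line_pts: "card (line_pts n ab) = n"
  unfolding line_pts_def by (subst card_image) (auto simp: inj_on_def)

lemma card_line_pts_Int:
  assumes "ab \<noteq> cd"
  shows "card (line_pts n ab \<inter> line_pts n cd) \<le> 1"
proof -
  have "p = q" if pq: "p \<in> line_pts n ab \<inter> line_pts n cd" "q \<in> line_pts n ab \<inter> line_pts n cd" for p q
  proof (rule ccontr)
    assume ne: "p \<noteq> q"
    obtain x where x: "p = (x, fst ab * x + snd ab)" "fst ab * x + snd ab = fst cd * x + snd cd"
      using pq(1) by (auto simp: line_pts_def)
    obtain z where z: "q = (z, fst ab * z + snd ab)" "fst ab * z + snd ab = fst cd * z + snd cd"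
      using pq(2) by (auto simp: line_pts_def)
    have "int (fst ab) * int x + int (snd ab) = int (fst cd) * int x + int (snd cd)"
      using x(2) by (simp flip: of_nat_mult of_nat_add)
    moreover have "int (fst ab) * int z + int (snd ab) = int (fst cd) * int z + int (snd cd)"
      using z(2) by (simp flip: of_nat_mult of_nat_add)
    ultimately have "(int (fst ab) - int (fst cd)) * (int x - int z) = 0"
      by (simp add: algebra_simps)
    then have "fst ab = fst cd" using ne x z by auto
    then show False using x(2) assms by (simp add: prod_eq_iff)
  qed
  then show ?thesis by (metis card_le_Suc0_iff_eq One_nat_def card.infinite le0)
qed

lemma two_mult_add_less: "0 < x \<Longrightarrow> a \<le> b \<Longrightarrow> 2 * b \<le> x \<Longrightarrow> 2 * (a + x) < 4 * x" for a b x :: nat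
  by simp

text \<open>The lines \<open>y = ax + b\<close> are the variables of the first kind and the grid points those of the
  second. A 0-certificate asserts a line and negates its points; a 1-certificate asserts a set of
  points and negates the few lines that it misses.\<close>

lemma exists_line_certs:
  fixes m :: nat
  assumes m: "7 \<le> m"
  defines "s \<equiv> 2 ^ m"
  defines "k \<equiv> 16 * m * s ^ 3"
  obtains U :: "(nat \<times> nat + nat \<times> nat) set" and CA where
    "finite U" "card U = s ^ 4 + 2 * s ^ 5"
    "\<And>z P Q. (P, Q) \<in> CA z \<Longrightarrow> P \<union> Q \<subseteq> U \<and> P \<inter> Q = {} \<and> P \<noteq> {} \<and> card (P \<union> Q) \<le> 2 * k"
    "\<And>c c'. c \<in> CA False \<Longrightarrow> c' \<in> CA True \<Longrightarrow> conflict c c'"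
    "\<And>I z. I \<subseteq> U \<Longrightarrow> 32 * card I \<le> s ^ 4 \<Longrightarrow> \<exists>(P, Q)\<in>CA z. P \<inter> I = {}"
    "finite (CA False \<union> CA True)" "card (CA False \<union> CA True) \<le> 2 ^ (8 * m * k)"
proof -
  \<comment> \<open>\<open>h\<close> is a quarter of the line size \<open>s ^ 2\<close>, so
    \<open>h * s ^ 2 = 4 * h\<^sup>2\<close>, while \<open>32 * card I \<le> s ^ 4\<close> means
    \<open>2 * card I \<le> h\<^sup>2\<close>. This is the strict inequality that
    \<open>hitting_set_avoiding\<close> asks for.\<close>
  define h where "h = (2::nat) ^ (2 * m - 2)"
  have h: "4 * h = s ^ 2"
  proof -
    have "4 * h = 2 ^ (2 + (2 * m - 2))" unfolding h_def by (simp only: power_add) simp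
    also have "2 + (2 * m - 2) = m * 2" using m by simp
    finally show ?thesis by (simp add: s_def power_mult)
  qed
  have ms: "16 * m < s"
    unfolding s_def using m by (induction m rule: dec_induct) auto
  have s4: "4 \<le> s" using power_increasing[OF m, of "2::nat"] by (simp add: s_def)
  have s32: "s ^ 2 \<le> s ^ 3" using s4 by (intro power_increasing) auto
  have sk: "s ^ 3 \<le> k" using m by (simp add: k_def)
  have s2k: "s ^ 2 \<le> k" using s32 sk by (rule order_trans)
  have k1: "1 \<le> k" using s4 s2k one_le_power[of s 2] by linarith
  define L where "L = {..<s} \<times> {..<s ^ 3}"
  define W where "W = {..<s ^ 2} \<times> {..<2 * s ^ 3}"
  define Nb where "Nb = line_pts (s ^ 2)"
  define missed where "missed = (\<lambda>P. {i\<in>L. Nb i \<inter> P = {}})"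
  have finLW: "finite L" "finite W" by (auto simp: L_def W_def)
  have cardL: "card L = s ^ 4" by (simp add: L_def card_cartesian_product flip: power_Suc)
  have cardW: "card W = 2 * s ^ 5" by (simp add: W_def card_cartesian_product flip: power_add)
  have NbW: "Nb i \<subseteq> W" if "i \<in> L" for i
  proof -
    obtain a b where i: "i = (a, b)" "a < s" "b < s ^ 3" using \<open>i \<in> L\<close> by (auto simp: L_def)
    have "a * x + b < 2 * s ^ 3" if "x < s ^ 2" for x
    proof -
      have "a * x \<le> s * s ^ 2" using that i by (intro mult_mono) auto
      also have "\<dots> = s ^ 3" by (simp flip: power_Suc)
      finally show ?thesis using i by simp
    qed
    then show ?thesis by (auto simp: Nb_def line_pts_def i(1) W_def)
  qed
  define U :: "(nat \<times> nat + nat \<times> nat) set" where "U = Inl ` L \<union> Inr ` W"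
  define C0 :: "((nat \<times> nat + nat \<times> nat) set \<times> (nat \<times> nat + nat \<times> nat) set) set"
    where "C0 = (\<lambda>i. ({Inl i}, Inr ` Nb i)) ` L"
  define C1 :: "((nat \<times> nat + nat \<times> nat) set \<times> (nat \<times> nat + nat \<times> nat) set) set"
    where "C1 = (\<lambda>P. (Inr ` P, Inl ` missed P)) `
    {P. P \<subseteq> W \<and> card P \<le> k \<and> card (missed P) \<le> k}"
  define CA where "CA = (\<lambda>z. if z then C1 else C0)"
  have finU: "finite U" using finLW by (simp add: U_def)
  have cardU: "card U = s ^ 4 + 2 * s ^ 5"
    unfolding U_def using finLW by (subst card_Un_disjoint) (auto simp: card_image cardL cardW)
  have wf0: "P \<union> Q \<subseteq> U \<and> P \<inter> Q = {} \<and> P \<noteq> {} \<and> card (P \<union> Q) \<le> 2 * k" if PQ: "(P, Q) \<in> C0" for P Q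
  proof -
    obtain i where i: "i \<in> L" "P = {Inl i}" "Q = Inr ` Nb i" using PQ by (auto simp: C0_def)
    have "card (P \<union> Q) \<le> card P + card Q" by (rule card_Un_le)
    also have "card Q = s ^ 2" by (simp add: i card_image Nb_def card_line_pts)
    also have "card P + s ^ 2 \<le> 2 * k" using s2k k1 i by simp
    finally show ?thesis using i NbW[OF i(1)] by (auto simp: U_def)
  qed
  have wf1: "P \<union> Q \<subseteq> U \<and> P \<inter> Q = {} \<and> P \<noteq> {} \<and> card (P \<union> Q) \<le> 2 * k" if PQ: "(P, Q) \<in> C1" for P Q
  proof -
    obtain R where R: "R \<subseteq> W" "card R \<le> k" "card (missed R) \<le> k" "P = Inr ` R" "Q = Inl ` missed R"
      using PQ by (auto simp: C1_def)
    have "card (P \<union> Q) \<le> card P + card Q" by (rule card_Un_le)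
    also have "\<dots> \<le> 2 * k" using R by (simp add: card_image)
    finally have c: "card (P \<union> Q) \<le> 2 * k" .
    \<comment> \<open>The empty set of points would miss all lines, more than a 1-certificate may
      negate; hence the positive part is nonempty.\<close>
    have "k < card L" using ms s4 by (simp add: k_def cardL power_Suc[of s 3, simplified])
    then have "R \<noteq> {}" using R(3) by (auto simp: missed_def)
    then show ?thesis using c R by (auto simp: U_def missed_def)
  qed
  show ?thesis
  proof (rule that[of U CA])
    show "finite U" "card U = s ^ 4 + 2 * s ^ 5" by fact+
    show "P \<union> Q \<subseteq> U \<and> P \<inter> Q = {} \<and> P \<noteq> {} \<and> card (P \<union> Q) \<le> 2 * k" if "(P, Q) \<in> CA z" for z P Q
      using that wf0[of P Q] wf1[of P Q] by (simp add: CA_def split: if_splits)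
  next
    fix c c' assume cc: "c \<in> CA False" "c' \<in> CA True"
    then obtain i P where "i \<in> L" "c = ({Inl i}, Inr ` Nb i)" "c' = (Inr ` P, Inl ` missed P)"
      by (auto simp: CA_def C0_def C1_def)
    \<comment> \<open>If \<open>P\<close> meets line \<open>i\<close>, a common point is asserted by
      \<open>c'\<close> and negated by \<open>c\<close>; otherwise \<open>i\<close> is missed, so
      \<open>c\<close> asserts it and \<open>c'\<close> negates it.\<close>
    then show "conflict c c'" by (auto simp: conflict_def missed_def)
  next
    fix I z assume I: "I \<subseteq> U" "32 * card I \<le> s ^ 4"
    have finI: "finite I" using I finU finite_subset by blast
    have "0 < s ^ 4" using s4 by simp
    show "\<exists>(P, Q)\<in>CA z. P \<inter> I = {}"
    proof (cases z)
      case False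
      \<comment> \<open>A 0-certificate asserts only its line, so any line variable outside
        \<open>I\<close> serves.\<close>
      have "card (Inl -` I) \<le> card I" using finI card_vimage_inj_on_le[of Inl UNIV I] by simp
      also have "card I < card L" using I(2) \<open>0 < s ^ 4\<close> unfolding cardL by linarith
      finally have "\<not> L \<subseteq> Inl -` I" using finI by (metis card_mono finite_vimageI inj_Inl not_le)
      then show ?thesis using False by (force simp: CA_def C0_def)
    next
      case True
      let ?I = "Inr -` I"
      have cI: "card ?I \<le> card I" using finI card_vimage_inj_on_le[of Inr UNIV I] by simp
      have "\<exists>P\<subseteq>W - ?I. card P \<le> k \<and> card {i\<in>L. Nb i \<inter> P = {}} < h"
      proof (rule hitting_set_avoiding[where g = "s ^ 2"])
        have "(0, 0) \<in> W" using s4 by (simp add: W_def)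
        then show "W \<noteq> {}" by blast
        show "card (Nb i \<inter> Nb j) \<le> 1" if "i \<noteq> j" for i j
          unfolding Nb_def by (rule card_line_pts_Int[OF that])
        show "finite ?I" using finI by (intro finite_vimageI) auto
        have "s ^ 4 = (s ^ 2) ^ 2" by (simp flip: power_mult)
        also have "\<dots> = (4 * h) ^ 2" by (simp only: h)
        also have "\<dots> = 16 * h\<^sup>2" by (simp add: power2_eq_square)
        finally have s4h: "s ^ 4 = 16 * h\<^sup>2" .
        have "0 < h\<^sup>2" by (simp add: h_def)
        have "2 * card I \<le> h\<^sup>2" using I(2) s4h by simp
        then have "2 * (card ?I + h\<^sup>2) < 4 * h\<^sup>2"
          by (rule two_mult_add_less[OF \<open>0 < h\<^sup>2\<close> cI])
        also have "4 * h\<^sup>2 = h * s\<^sup>2" unfolding h[symmetric] by (simp add: power2_eq_square)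
        finally show "2 * (card ?I + h\<^sup>2) < h * s\<^sup>2" .
        show "s ^ 2 \<le> card W" unfolding cardW
          using s4 by (intro trans_le_add1[of _ "s ^ 5" "s ^ 5", folded mult_2] power_increasing) auto
        \<comment> \<open>Each greedy pick hits a \<open>1 / (4 * s ^ 3)\<close> fraction of the
          remaining lines. With \<open>k = 16 * m * s ^ 3\<close> picks the factor is at most
          \<open>exp (- 4 * m)\<close>, which beats the number \<open>s ^ 4 = 2 ^ (4 * m)\<close> of
          lines.\<close>
        have "(1 - real (s\<^sup>2) / (2 * real (card W))) ^ k \<le> (exp (- (1 / (4 * real s ^ 3)))) ^ k"
        proof (rule power_mono)
          have "real (s\<^sup>2) / (2 * real (card W)) = 1 / (4 * real s ^ 3)"
            using s4 by (simp add: cardW field_simps flip: power_add)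
          then show "1 - real (s\<^sup>2) / (2 * real (card W)) \<le> exp (- (1 / (4 * real s ^ 3)))"
            using exp_ge_add_one_self[of "- (1 / (4 * real s ^ 3))"] by simp
          have "1 \<le> real s ^ 3" using s4 by (intro one_le_power) auto
          then have "0 < 4 * real s ^ 3" "1 \<le> 4 * real s ^ 3" by linarith+
          then have "1 / (4 * real s ^ 3) \<le> 1" by (simp only: divide_le_eq_1_pos)
          then show "0 \<le> 1 - real (s\<^sup>2) / (2 * real (card W))"
            using \<open>real (s\<^sup>2) / (2 * real (card W)) = 1 / (4 * real s ^ 3)\<close> by simp
        qed
        also have "\<dots> = exp (real k * (- (1 / (4 * real s ^ 3))))" by (rule exp_of_nat_mult[symmetric])
        also have "real k * (- (1 / (4 * real s ^ 3))) = real (4 * m) * (- 1)"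
          using s4 by (simp add: k_def)
        also have "exp (real (4 * m) * (- 1 :: real)) = exp (- 1) ^ (4 * m)" by (rule exp_of_nat_mult)
        also have "exp (- 1 :: real) ^ (4 * m) < (1 / 2) ^ (4 * m)"
        proof (rule power_strict_mono)
          have "2 < exp (1 :: real)" using exp_lower_Taylor_quadratic[of 1] by simp
          then show "exp (- 1 :: real) < 1 / 2" by (simp add: exp_minus field_simps)
        qed (use m in auto)
        finally have "(1 - real (s\<^sup>2) / (2 * real (card W))) ^ k < (1 / 2) ^ (4 * m)" .
        moreover have "real (card L) * (1 / 2) ^ (4 * m) = 1"
          by (simp add: cardL s_def power_divide mult.commute flip: power_mult)
        moreover have "0 < real (card L)" using s4 by (simp add: cardL)
        ultimately show "real (card L) * (1 - real (s\<^sup>2) / (2 * real (card W))) ^ k < 1"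
          by (metis mult_less_cancel_left_pos)
      qed (use finLW NbW in \<open>auto simp: Nb_def card_line_pts\<close>)
      then obtain P where P: "P \<subseteq> W - ?I" "card P \<le> k" "card (missed P) < h" by (auto simp: missed_def)
      have "h \<le> k" using h s2k by linarith
      then have "(Inr ` P, Inl ` missed P) \<in> CA z"
        unfolding CA_def C1_def using P True by (auto intro!: imageI)
      moreover have "Inr ` P \<inter> I = {}" using P(1) by auto
      ultimately show ?thesis by blast
    qed
  next
    have finC: "finite C0" "finite C1" using finLW by (auto simp: C0_def C1_def)
    then show "finite (CA False \<union> CA True)" by (simp add: CA_def)
    have "card (C0 \<union> C1) \<le> card C0 + card C1" by (rule card_Un_le)
    also have "card C0 \<le> 2 ^ (4 * m)"
      using card_image_le[OF finLW(1)] by (simp add: C0_def cardL s_def mult.commute flip: power_mult)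
    also have "card C1 \<le> (2 ^ (5 * m + 2)) ^ k"
    proof -
      have "card C1 \<le> card {P. P \<subseteq> W \<and> card P \<le> k \<and> card (missed P) \<le> k}"
        unfolding C1_def using finLW by (intro card_image_le) auto
      also have "\<dots> \<le> card {P. P \<subseteq> W \<and> card P \<le> k}" using finLW by (intro card_mono) auto
      also have "\<dots> \<le> (card W + 1) ^ k" by (rule card_subsets_bounded_card[OF finLW(2)])
      also have "\<dots> \<le> (2 ^ (5 * m + 2)) ^ k"
        by (intro power_mono) (simp_all add: cardW s_def power_add mult.commute flip: power_mult)
      finally show ?thesis .
    qed
    also have "2 ^ (4 * m) + (2 ^ (5 * m + 2)) ^ k \<le> (2::nat) ^ (8 * m * k)"
    proof -
      have "4 * m * 1 \<le> (5 * m + 2) * k" using k1 by (intro mult_le_mono) auto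
      then have *: "(2::nat) ^ (4 * m) \<le> 2 ^ ((5 * m + 2) * k)" by (intro power_increasing) auto
      have "2 ^ (4 * m) + (2 ^ (5 * m + 2)) ^ k = 2 ^ (4 * m) + (2::nat) ^ ((5 * m + 2) * k)"
        by (simp only: power_mult)
      also have "\<dots> \<le> 2 ^ ((5 * m + 2) * k) + 2 ^ ((5 * m + 2) * k)" by (rule add_right_mono[OF *])
      also have "\<dots> = 2 ^ ((5 * m + 2) * k + 1)" by simp
      also have "\<dots> \<le> 2 ^ (8 * m * k)"
      proof (rule power_increasing)
        have "(5 * m + 2) * k + 1 \<le> (5 * m + 3) * k" using k1 by (simp add: algebra_simps)
        also have "\<dots> \<le> 8 * m * k" using m by (intro mult_right_mono) auto
        finally show "(5 * m + 2) * k + 1 \<le> 8 * m * k" .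
      qed simp
      finally show ?thesis .
    qed
    finally show "card (CA False \<union> CA True) \<le> 2 ^ (8 * m * k)" by (simp add: CA_def Un_commute)
  qed
qed

section \<open>Cheat sheets\<close>

text \<open>The cheat sheet construction. A term carries \<open>l\<close> certificates whose types form an address \<open>a\<close>,
  together with a codeword, stored in the block of \<open>a\<close>, that determines all of them. Terms with
  different addresses conflict in some copy, terms with the same address in the codeword.\<close>

lemma exists_terms:
  fixes CA :: "bool \<Rightarrow> ('u set \<times> 'u set) set"
  assumes U: "finite U"
    and wf: "\<And>z P Q. (P, Q) \<in> CA z \<Longrightarrow> P \<union> Q \<subseteq> U \<and> P \<inter> Q = {} \<and> P \<noteq> {} \<and> card (P \<union> Q) \<le> k"
    and conf: "\<And>c c'. c \<in> CA False \<Longrightarrow> c' \<in> CA True \<Longrightarrow> conflict c c'"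
    and avoid: "\<And>I z. I \<subseteq> U \<Longrightarrow> card I \<le> n \<Longrightarrow> \<exists>(P, Q)\<in>CA z. P \<inter> I = {}"
    and code: "finite (CA False \<union> CA True)" "card (CA False \<union> CA True) \<le> 2 ^ b"
    and l: "n < 2 ^ l" "0 < l"
  obtains V :: "(nat \<times> 'u + nat set \<times> nat \<times> nat) set" and TT where
    "finite V" "card V = l * card U + 2 ^ l * (l * b)"
    "finite TT" "card TT \<le> 2 ^ (l * (1 + b))"
    "\<And>P Q. (P, Q) \<in> TT \<Longrightarrow> P \<union> Q \<subseteq> V \<and> P \<inter> Q = {} \<and> P \<noteq> {} \<and> card (P \<union> Q) \<le> l * (k + b)"
    "\<And>T T'. T \<in> TT \<Longrightarrow> T' \<in> TT \<Longrightarrow> T \<noteq> T' \<Longrightarrow> conflict T T'"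
    "\<And>I. I \<subseteq> V \<Longrightarrow> card I \<le> n \<Longrightarrow> \<exists>(P, Q)\<in>TT. P \<inter> I = {}"
proof -
  define CC where "CC = CA False \<union> CA True"
  have CAC: "CA z \<subseteq> CC" for z by (cases z) (auto simp: CC_def)
  have fin: "finite CC" "card CC \<le> 2 ^ b" using code by (auto simp: CC_def)
  have "card CC \<le> card (Pow {..<b})" using fin(2) by (simp add: card_Pow)
  then obtain \<phi> where \<phi>: "\<phi> ` CC \<subseteq> Pow {..<b}" "inj_on \<phi> CC"
    using card_le_inj[of CC "Pow {..<b}"] fin(1) by auto
  have wfC: "P \<union> Q \<subseteq> U \<and> P \<inter> Q = {} \<and> P \<noteq> {} \<and> card (P \<union> Q) \<le> k" if "(P, Q) \<in> CC" for P Q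
    using that wf unfolding CC_def by blast
  \<comment> \<open>\<open>Inl (i, u)\<close> is the variable \<open>u\<close> of copy
    \<open>i\<close>, and \<open>Inr (a, i, j)\<close> is bit \<open>j\<close> of the word for copy
    \<open>i\<close> in block \<open>a\<close>. A term fixes every bit of its own block and no bit
    of another one.\<close>
  define Pt where "Pt = (\<lambda>(a :: nat set) f. Inl ` (SIGMA i:{..<l}. fst (f i)) \<union> Inr ` ({a} \<times> (SIGMA i:{..<l}. \<phi> (f i))))"
  define Qt where "Qt = (\<lambda>(a :: nat set) f. Inl ` (SIGMA i:{..<l}. snd (f i)) \<union>
    Inr ` ({a} \<times> (SIGMA i:{..<l}. {..<b} - \<phi> (f i))))"
  define Ix where "Ix = (SIGMA a:Pow {..<l}. \<Pi>\<^sub>E i\<in>{..<l}. CA (i \<in> a))"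
  define TT where "TT = (\<lambda>(a, f). (Pt a f, Qt a f)) ` Ix"
  define V :: "(nat \<times> 'u + nat set \<times> nat \<times> nat) set"
    where "V = Inl ` ({..<l} \<times> U) \<union> Inr ` (Pow {..<l} \<times> {..<l} \<times> {..<b})"
  have finV: "finite V" using U by (simp add: V_def)
  have cardV: "card V = l * card U + 2 ^ l * (l * b)"
    unfolding V_def using U
    by (subst card_Un_disjoint) (auto simp: card_image card_cartesian_product card_Pow)
  have fC: "f i \<in> CA (i \<in> a)" "f i \<in> CC" "\<phi> (f i) \<subseteq> {..<b}" if "(a, f) \<in> Ix" "i < l" for a f i
  proof -
    show "f i \<in> CA (i \<in> a)" using that by (auto simp: Ix_def)
    then show "f i \<in> CC" using CAC by blast
    then show "\<phi> (f i) \<subseteq> {..<b}" using \<phi>(1) by blast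
  qed
  have IxS: "Ix \<subseteq> Pow {..<l} \<times> ({..<l} \<rightarrow>\<^sub>E CC)"
    using CAC by (auto simp: Ix_def PiE_iff)
  have finS: "finite (Pow {..<l} \<times> ({..<l} \<rightarrow>\<^sub>E CC))"
    using fin by (intro finite_cartesian_product finite_PiE) auto
  have finIx: "finite Ix" using IxS finS by (rule finite_subset)
  have finTT: "finite TT" using finIx by (simp add: TT_def)
  have cardTT: "card TT \<le> 2 ^ (l * (1 + b))"
  proof -
    have "card TT \<le> card Ix" unfolding TT_def by (rule card_image_le[OF finIx])
    also have "\<dots> \<le> card (Pow {..<l} \<times> ({..<l} \<rightarrow>\<^sub>E CC))" by (rule card_mono[OF finS IxS])
    also have "\<dots> = 2 ^ l * card CC ^ l" by (simp add: card_cartesian_product card_Pow card_PiE)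
    also have "\<dots> \<le> 2 ^ l * (2 ^ b) ^ l" using fin(2) by (intro mult_left_mono power_mono) auto
    also have "\<dots> = 2 ^ (l * (1 + b))" by (simp add: power_add algebra_simps flip: power_mult)
    finally show ?thesis .
  qed
  have wfT: "P \<union> Q \<subseteq> V \<and> P \<inter> Q = {} \<and> P \<noteq> {} \<and> card (P \<union> Q) \<le> l * (k + b)" if PQ: "(P, Q) \<in> TT" for P Q
  proof -
    obtain a f where af: "(a, f) \<in> Ix" "P = Pt a f" "Q = Qt a f" using PQ by (auto simp: TT_def)
    have a: "a \<subseteq> {..<l}" using af by (auto simp: Ix_def)
    have w: "fst (f i) \<union> snd (f i) \<subseteq> U" "fst (f i) \<inter> snd (f i) = {}" "fst (f i) \<noteq> {}"
      "card (fst (f i) \<union> snd (f i)) \<le> k" "finite (fst (f i) \<union> snd (f i))" if "i < l" for i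
      using wfC[of "fst (f i)" "snd (f i)"] fC(2)[OF af(1) that] U finite_subset by auto
    have "P \<union> Q \<subseteq> Inl ` (SIGMA i:{..<l}. fst (f i) \<union> snd (f i)) \<union> Inr ` ({a} \<times> {..<l} \<times> {..<b})"
      using fC(3)[OF af(1)] by (auto simp: af Pt_def Qt_def)
    moreover have finU: "finite (SIGMA i:{..<l}. fst (f i) \<union> snd (f i))"
      using w by (intro finite_SigmaI) auto
    ultimately have "card (P \<union> Q) \<le> card (Inl ` (SIGMA i:{..<l}. fst (f i) \<union> snd (f i)) \<union>
        (Inr ` ({a} \<times> {..<l} \<times> {..<b}) :: (nat \<times> 'u + nat set \<times> nat \<times> nat) set))"
      by (intro card_mono) auto
    also have "\<dots> \<le> card (Inl ` (SIGMA i:{..<l}. fst (f i) \<union> snd (f i)) :: (nat \<times> 'u + nat set \<times> nat \<times> nat) set)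
        + card (Inr ` ({a} \<times> {..<l} \<times> {..<b}) :: (nat \<times> 'u + nat set \<times> nat \<times> nat) set)"
      by (rule card_Un_le)
    also have "\<dots> = card (SIGMA i:{..<l}. fst (f i) \<union> snd (f i)) + l * b"
      by (simp add: card_image card_cartesian_product)
    also have "card (SIGMA i:{..<l}. fst (f i) \<union> snd (f i)) = (\<Sum>i<l. card (fst (f i) \<union> snd (f i)))"
      using w by (intro card_SigmaI) auto
    also have "\<dots> \<le> (\<Sum>i<l. k)" using w by (intro sum_mono) auto
    finally have "card (P \<union> Q) \<le> l * (k + b)" by (simp add: algebra_simps)
    moreover have "P \<union> Q \<subseteq> V"
      using w(1) fC(3)[OF af(1)] a unfolding af Pt_def Qt_def V_def by fastforce
    moreover have "P \<inter> Q = {}" using w(2) by (auto simp: af Pt_def Qt_def)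
    moreover have "P \<noteq> {}" using w(3)[OF l(2)] l(2) by (auto simp: af Pt_def)
    ultimately show ?thesis by blast
  qed
  have sym: "conflict c c' \<longleftrightarrow> conflict c' c" for c c' :: "'u set \<times> 'u set"
    by (auto simp: conflict_def)
  have confT: "conflict T T'" if "T \<in> TT" "T' \<in> TT" "T \<noteq> T'" for T T'
  proof -
    obtain a f where T: "(a, f) \<in> Ix" "T = (Pt a f, Qt a f)" using \<open>T \<in> TT\<close> by (auto simp: TT_def)
    obtain a' f' where T': "(a', f') \<in> Ix" "T' = (Pt a' f', Qt a' f')" using \<open>T' \<in> TT\<close> by (auto simp: TT_def)
    have "(a, f) \<noteq> (a', f')" using that T T' by auto
    then consider "a \<noteq> a'" | "a = a'" "f \<noteq> f'" by auto
    then show ?thesis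
    proof cases
      case 1
      then obtain i where i: "i \<in> a \<longleftrightarrow> i \<notin> a'" by blast
      moreover have "a \<subseteq> {..<l}" "a' \<subseteq> {..<l}" using T T' by (auto simp: Ix_def)
      ultimately have il: "i < l" by auto
      have "conflict (f i) (f' i)"
        using conf[of "f i" "f' i"] conf[of "f' i" "f i"] fC(1)[OF T(1) il] fC(1)[OF T'(1) il] i
        by (cases "i \<in> a") (auto simp: sym)
      then obtain u where "u \<in> fst (f i) \<inter> snd (f' i) \<or> u \<in> fst (f' i) \<inter> snd (f i)"
        by (auto simp: conflict_def)
      then have "Inl (i, u) \<in> Pt a f \<inter> Qt a' f' \<or> Inl (i, u) \<in> Pt a' f' \<inter> Qt a f"
        using il by (auto simp: Pt_def Qt_def)
      then show ?thesis unfolding T T' conflict_def by auto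
    next
      case 2
      have "\<exists>i<l. f i \<noteq> f' i"
      proof (rule ccontr)
        assume "\<not> ?thesis"
        moreover have "f \<in> {..<l} \<rightarrow>\<^sub>E CC" "f' \<in> {..<l} \<rightarrow>\<^sub>E CC" using T(1) T'(1) IxS by auto
        ultimately have "f = f'" by (intro PiE_ext) auto
        then show False using 2 by simp
      qed
      then obtain i where i: "i < l" "f i \<noteq> f' i" by blast
      then have "\<phi> (f i) \<noteq> \<phi> (f' i)"
        using \<phi>(2) fC(2)[OF T(1)] fC(2)[OF T'(1)] by (metis inj_onD)
      then obtain j where j: "j \<in> \<phi> (f i) \<longleftrightarrow> j \<notin> \<phi> (f' i)" by blast
      moreover have "j < b" using j fC(3)[OF T(1) i(1)] fC(3)[OF T'(1) i(1)] by blast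
      ultimately have "Inr (a, i, j) \<in> Pt a f \<inter> Qt a f' \<or> Inr (a, i, j) \<in> Pt a f' \<inter> Qt a f"
        using i(1) by (auto simp: Pt_def Qt_def)
      then show ?thesis unfolding T T' conflict_def 2(1)[symmetric] by auto
    qed
  qed
  have avoidT: "\<exists>(P, Q)\<in>TT. P \<inter> I = {}" if I: "I \<subseteq> V" "card I \<le> n" for I
  proof -
    have finI: "finite I" using I finV finite_subset by blast
    \<comment> \<open>Copy variables get the default address \<open>{}\<close>. This may rule out
      that block needlessly, but \<open>I\<close> still rules out at most
      \<open>card I < 2 ^ l\<close> addresses.\<close>
    define addr :: "nat \<times> 'u + nat set \<times> nat \<times> nat \<Rightarrow> nat set"
      where "addr = (\<lambda>v. case v of Inl _ \<Rightarrow> {} | Inr p \<Rightarrow> fst p)"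
    have "card (addr ` I) \<le> card I" by (rule card_image_le[OF finI])
    then have "card (addr ` I) < card (Pow {..<l})" using I l by (simp add: card_Pow)
    then have "\<not> Pow {..<l} \<subseteq> addr ` I" using finI by (meson card_mono finite_imageI not_le)
    then obtain a where a: "a \<subseteq> {..<l}" "a \<notin> addr ` I" by blast
    have "\<exists>c\<in>CA (i \<in> a). Inl ` ({i} \<times> fst c) \<inter> I = {}" for i
    proof -
      define Ii where "Ii = {u. Inl (i, u) \<in> I}"
      have "Ii = (\<lambda>u. Inl (i, u)) -` I" by (auto simp: Ii_def)
      then have "card Ii \<le> card I"
        using card_vimage_inj_on_le[of "\<lambda>u. Inl (i, u)" UNIV I] finI by (simp add: inj_on_def)
      moreover have "Ii \<subseteq> U" using I(1) by (auto simp: Ii_def V_def)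
      ultimately obtain P Q where "(P, Q) \<in> CA (i \<in> a)" "P \<inter> Ii = {}"
        using avoid[of Ii "i \<in> a"] I(2) by auto
      then show ?thesis by (intro bexI[of _ "(P, Q)"]) (auto simp: Ii_def)
    qed
    then have "\<exists>g. \<forall>i. g i \<in> CA (i \<in> a) \<and> Inl ` ({i} \<times> fst (g i)) \<inter> I = {}"
      by (intro choice) blast
    then obtain g where g: "\<And>i. g i \<in> CA (i \<in> a)" "\<And>i. Inl ` ({i} \<times> fst (g i)) \<inter> I = {}" by blast
    define f where "f = restrict g {..<l}"
    have "(a, f) \<in> Ix" using a(1) g(1) by (auto simp: Ix_def f_def)
    then have "(Pt a f, Qt a f) \<in> TT" by (force simp: TT_def)
    moreover have "Pt a f \<inter> I = {}"
    proof -
      have "Inl (i, u) \<notin> I" if "i < l" "u \<in> fst (f i)" for i u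
        using g(2)[of i] that by (auto simp: f_def)
      moreover have "Inr (a, i, j) \<notin> I" for i j
        using a(2) by (force simp: addr_def)
      ultimately show ?thesis by (auto simp: Pt_def)
    qed
    ultimately show ?thesis by blast
  qed
  show ?thesis by (rule that[OF finV cardV finTT cardTT wfT confT avoidT])
qed

section \<open>Classes all of whose disambiguations shatter a large set\<close>

text \<open>\<open>G h\<close> is one chosen completion of each concept. Keeping completions indexed
  by concepts makes the property inherited by larger classes and domains, as the infinite class
  requires.\<close>

definition forces :: "nat \<Rightarrow> 'p set \<Rightarrow> ('p \<Rightarrow> bool option) set \<Rightarrow> bool" where
  "forces d V H \<longleftrightarrow> (\<forall>G. (\<forall>h\<in>H. \<forall>x\<in>V. h x \<noteq> None \<longrightarrow> h x = Some (G h x)) \<longrightarrow>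
     (\<exists>S\<subseteq>V. finite S \<and> card S = d \<and> (\<forall>y. \<exists>h\<in>H. \<forall>x\<in>S. G h x = y x)))"

text \<open>A disambiguation promises agreement on finite sets only; \<open>V\<close> is finite, so
  each concept has a completion that is right on all of \<open>V\<close>.\<close>

lemma forces_disambiguation:
  assumes "forces d V H" "finite V" "V \<subseteq> X" "H \<subseteq> H'" "disambiguation X H' Hbar"
  shows "enat d \<le> VC Hbar"
proof -
  have ex: "\<exists>g. g \<in> Hbar \<and> (\<forall>x\<in>{x\<in>V. h x \<noteq> None}. g x = h x)" if "h \<in> H" for h
  proof -
    have "finite {x\<in>V. h x \<noteq> None}" "{x\<in>V. h x \<noteq> None} \<subseteq> {x\<in>X. h x \<noteq> None}"
      using assms by auto
    then show ?thesis using assms(4,5) that unfolding disambiguation_def by blast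
  qed
  define g where "g = (\<lambda>h. SOME g. g \<in> Hbar \<and> (\<forall>x\<in>{x\<in>V. h x \<noteq> None}. g x = h x))"
  have g: "g h \<in> Hbar" "\<And>x. x \<in> V \<Longrightarrow> h x \<noteq> None \<Longrightarrow> g h x = h x" if "h \<in> H" for h
    using someI_ex[OF ex[OF that]] unfolding g_def by auto
  have total: "g h x \<noteq> None" if "h \<in> H" "x \<in> V" for h x
  proof -
    have "total_class X Hbar" using assms(5) by (simp add: disambiguation_def)
    then show ?thesis using g(1)[OF that(1)] that(2) assms(3) unfolding total_class_def by blast
  qed
  have "\<forall>h\<in>H. \<forall>x\<in>V. h x \<noteq> None \<longrightarrow> h x = Some (the (g h x))"
    by (simp add: g(2))
  then have "\<exists>S\<subseteq>V. finite S \<and> card S = d \<and> (\<forall>y. \<exists>h\<in>H. \<forall>x\<in>S. the (g h x) = y x)"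
    by (rule assms(1)[unfolded forces_def, THEN spec, THEN mp])
  then obtain S where S: "S \<subseteq> V" "finite S" "card S = d" "\<And>y. \<exists>h\<in>H. \<forall>x\<in>S. the (g h x) = y x"
    by blast
  have "shatters Hbar S"
    unfolding shatters_def
  proof (intro conjI allI)
    fix y :: "'a \<Rightarrow> bool"
    obtain h where h: "h \<in> H" "\<forall>x\<in>S. the (g h x) = y x" using S(4) by blast
    have "g h x = Some (y x)" if "x \<in> S" for x
    proof -
      have "x \<in> V" using that S(1) by blast
      then have "g h x \<noteq> None" using total[OF h(1)] by blast
      then show ?thesis using h(2) that by auto
    qed
    then show "\<exists>h\<in>Hbar. \<forall>x\<in>S. h x = Some (y x)" using g(1)[OF h(1)] by blast
  qed (rule S)
  then show ?thesis unfolding VC_def using S(3) by (intro Sup_upper) blast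
qed

section \<open>Relabelling the points\<close>

definition transport :: "('p \<Rightarrow> 'q) \<Rightarrow> 'p set \<Rightarrow> ('p \<Rightarrow> bool option) \<Rightarrow> 'q \<Rightarrow> bool option" where
  "transport f V h z = (if z \<in> f ` V then h (inv_into V f z) else None)"

lemma partial_class_transport: "partial_class (f ` V) (transport f V ` H)"
  by (simp add: partial_class_def transport_def)

lemma thin_transport:
  assumes "thin H"
  shows "thin (transport f V ` H)"
  unfolding thin_def
proof (safe)
  fix h h' x y
  assume "h \<in> H" "h' \<in> H" "transport f V h x = Some True" "transport f V h' x = Some True"
    "transport f V h y = Some False" "transport f V h' y = Some False"
  then have "h = h'"
    using assms unfolding thin_def transport_def by (metis option.distinct(1))
  then show "transport f V h = transport f V h'" by simp
qed

lemma forces_transport: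
  assumes "forces d V H" "inj_on f V"
  shows "forces d (f ` V) (transport f V ` H)"
  unfolding forces_def
proof (intro allI impI)
  fix G assume G: "\<forall>h\<in>transport f V ` H. \<forall>x\<in>f ` V. h x \<noteq> None \<longrightarrow> h x = Some (G h x)"
  have tr: "transport f V h (f v) = h v" if "v \<in> V" for h v
    using that assms(2) by (simp add: transport_def)
  have "\<forall>h\<in>H. \<forall>x\<in>V. h x \<noteq> None \<longrightarrow> h x = Some (G (transport f V h) (f x))"
    using G tr by simp
  then have "\<exists>S\<subseteq>V. finite S \<and> card S = d \<and> (\<forall>y. \<exists>h\<in>H. \<forall>x\<in>S. G (transport f V h) (f x) = y x)"
    by (rule assms(1)[unfolded forces_def, THEN spec, THEN mp])
  then obtain S where S: "S \<subseteq> V" "finite S" "card S = d"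
    "\<And>y. \<exists>h\<in>H. \<forall>x\<in>S. G (transport f V h) (f x) = y x" by blast
  have "\<exists>h\<in>transport f V ` H. \<forall>x\<in>f ` S. G h x = y x" for y
    using S(4)[of "y \<circ> f"] by auto
  moreover have "card (f ` S) = d"
    using S assms(2) by (simp add: card_image inj_on_subset)
  ultimately have "f ` S \<subseteq> f ` V \<and> finite (f ` S) \<and> card (f ` S) = d \<and>
      (\<forall>y. \<exists>h\<in>transport f V ` H. \<forall>x\<in>f ` S. G h x = y x)"
    using S by blast
  then show "\<exists>S\<subseteq>f ` V. finite S \<and> card S = d \<and> (\<forall>y. \<exists>h\<in>transport f V ` H. \<forall>x\<in>S. G h x = y x)"
    by (rule exI)
qed

text \<open>The concept of a term \<open>(P, Q)\<close> and addresses \<open>s\<close> separates the points whose \<open>x\<close> uses these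
  addresses from those whose \<open>y\<close> satisfies the term there; no point does both, as it decodes to zero.\<close>

definition term_concept :: "'u set \<Rightarrow> nat \<Rightarrow> ('u set \<times> 'u set) \<times> ('u \<Rightarrow> nat)
    \<Rightarrow> ('u \<Rightarrow> nat) \<times> ('u \<Rightarrow> nat set) \<Rightarrow> bool option" where
  "term_concept U r T p =
    (if p \<notin> lifted_points U r then None
     else if \<forall>u\<in>fst (fst T) \<union> snd (fst T). fst p u = snd T u then Some True
     else if \<forall>u\<in>fst (fst T) \<union> snd (fst T). snd T u \<in> snd p u \<longleftrightarrow> u \<in> fst (fst T) then Some False
     else None)"

text \<open>Conflicting terms make the class thin, and the failure of every colouring with
  \<open>r ^ c\<close> colours makes it force: a completion with that few columns would colour the
  points by their columns and thereby separate every biclique.\<close>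

lemma exists_lifted_class:
  fixes TT :: "('u set \<times> 'u set) set"
  assumes U: "finite U" and t: "2 \<le> t" and r: "r = t ^ 2" and w: "1 \<le> w"
    and TT: "finite TT" "card TT \<le> 2 ^ w"
      "\<And>P Q. (P, Q) \<in> TT \<Longrightarrow> P \<union> Q \<subseteq> U \<and> P \<inter> Q = {} \<and> P \<noteq> {} \<and> card (P \<union> Q) \<le> w"
    and conf: "\<And>T T'. T \<in> TT \<Longrightarrow> T' \<in> TT \<Longrightarrow> T \<noteq> T' \<Longrightarrow> conflict T T'"
    and avoid: "\<And>I. I \<subseteq> U \<Longrightarrow> card I \<le> 2 * c \<Longrightarrow> \<exists>(P, Q)\<in>TT. P \<inter> I = {}"
    and num: "real w * (2 * (2 * real r) ^ w * exp (- ((1 / (4 * real w))\<^sup>2 * real t / 4)))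
      * 2 ^ card U * real r ^ c < 1"
    and d: "((2 * r) ^ w + 1) ^ (2 ^ d) \<le> r ^ c"
  obtains H where "thin H" "partial_class (lifted_points U r) H" "forces d (lifted_points U r) H"
proof -
  define Ix where "Ix = (SIGMA T:TT. fst T \<union> snd T \<rightarrow>\<^sub>E {..<r})"
  define H where "H = term_concept U r ` Ix"
  have r1: "1 \<le> r" using t r by simp
  have fT: "finite (fst T \<union> snd T)" "card (fst T \<union> snd T) \<le> w" "fst T \<inter> snd T = {}" "fst T \<noteq> {}"
    if "T \<in> TT" for T
    using TT(3)[of "fst T" "snd T"] that U finite_subset by auto
  have finIx: "finite Ix" unfolding Ix_def using TT fT by (intro finite_SigmaI finite_PiE) auto
  have finH: "finite H" using finIx by (simp add: H_def)
  have cardH: "card H \<le> (2 * r) ^ w"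
  proof -
    have "card H \<le> card Ix" unfolding H_def by (rule card_image_le[OF finIx])
    also have "\<dots> = (\<Sum>T\<in>TT. card (fst T \<union> snd T \<rightarrow>\<^sub>E {..<r}))"
      unfolding Ix_def using TT fT by (intro card_SigmaI ballI finite_PiE) auto
    also have "\<dots> \<le> (\<Sum>T\<in>TT. r ^ w)"
      using fT r1 by (intro sum_mono) (simp add: card_PiE power_increasing)
    also have "\<dots> = card TT * r ^ w" by simp
    also have "\<dots> \<le> 2 ^ w * r ^ w" using TT(2) by (rule mult_le_mono1)
    finally show ?thesis by (simp add: power_mult_distrib)
  qed
  have "thin H"
    unfolding thin_def
  proof (intro ballI allI impI, elim conjE)
    fix h h' p q
    assume "h \<in> H" "h' \<in> H" and v: "h p = Some True" "h' p = Some True" "h q = Some False" "h' q = Some False"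
    then obtain T s T' s' where T: "T \<in> TT" "s \<in> fst T \<union> snd T \<rightarrow>\<^sub>E {..<r}" "h = term_concept U r (T, s)"
      and T': "T' \<in> TT" "s' \<in> fst T' \<union> snd T' \<rightarrow>\<^sub>E {..<r}" "h' = term_concept U r (T', s')"
      by (auto simp: H_def Ix_def)
    have e: "fst p u = s u" "s u \<in> snd q u \<longleftrightarrow> u \<in> fst T" if "u \<in> fst T \<union> snd T" for u
      using v(1,3) that unfolding T(3) term_concept_def by (auto split: if_splits)
    have e': "fst p u = s' u" "s' u \<in> snd q u \<longleftrightarrow> u \<in> fst T'" if "u \<in> fst T' \<union> snd T'" for u
      using v(2,4) that unfolding T'(3) term_concept_def by (auto split: if_splits)
    \<comment> \<open>Both address functions agree with \<open>fst p\<close>, so both terms hold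
      under the one assignment that reads \<open>snd q\<close> at the addresses
      \<open>fst p\<close>.\<close>
    have "\<not> conflict T T'"
    proof
      assume "conflict T T'"
      then obtain u where "u \<in> fst T \<inter> snd T' \<or> u \<in> fst T' \<inter> snd T" by (auto simp: conflict_def)
      then show False using e[of u] e'[of u] fT(3)[OF T(1)] fT(3)[OF T'(1)] by auto
    qed
    then have "T = T'" using conf T(1) T'(1) by blast
    moreover have "s = s'"
      by (rule PiE_ext[OF T(2)]) (use T' \<open>T = T'\<close> e(1) e'(1) in auto)
    ultimately show "h = h'" using T T' by simp
  qed
  moreover have "partial_class (lifted_points U r) H"
    by (auto simp: partial_class_def H_def term_concept_def)
  moreover have "forces d (lifted_points U r) H"
    unfolding forces_def
  proof (intro allI impI)
    fix G assume G: "\<forall>h\<in>H. \<forall>x\<in>lifted_points U r. h x \<noteq> None \<longrightarrow> h x = Some (G h x)"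
    define \<kappa> where "\<kappa> = (\<lambda>v. {h\<in>H. G h v})"
    have "r ^ c < card (\<kappa> ` lifted_points U r)"
    proof (rule ccontr)
      assume "\<not> r ^ c < card (\<kappa> ` lifted_points U r)"
      then have "card (\<kappa> ` lifted_points U r) \<le> r ^ c" by simp
      then have "\<exists>(P, Q)\<in>TT. \<exists>(x, y)\<in>lifted_points U r. \<exists>(x', y')\<in>lifted_points U r.
          \<kappa> (x, y) = \<kappa> (x', y') \<and> (\<forall>u\<in>P \<union> Q. x u \<in> y' u \<longleftrightarrow> u \<in> P)"
        using U t r w TT(3) avoid num by (intro monochromatic_separated_pair) auto
      then obtain P Q x y x' y' where PQ: "(P, Q) \<in> TT"
        and xy: "(x, y) \<in> lifted_points U r" "(x', y') \<in> lifted_points U r"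
        and eq: "\<kappa> (x, y) = \<kappa> (x', y')" and sat: "\<forall>u\<in>P \<union> Q. x u \<in> y' u \<longleftrightarrow> u \<in> P"
        by blast
      \<comment> \<open>The concept of the violated term at the addresses of \<open>x\<close> has
        value 1 at the first point and 0 at the second, against the equality of their
        columns.\<close>
      define h where "h = term_concept U r ((P, Q), restrict x (P \<union> Q))"
      have PQU: "P \<union> Q \<subseteq> U" "P \<noteq> {}" using TT(3)[OF PQ] by auto
      have "restrict x (P \<union> Q) \<in> P \<union> Q \<rightarrow>\<^sub>E {..<r}"
        using xy(1) PQU(1) by (auto simp: lifted_points_def PiE_iff)
      then have hH: "h \<in> H" using PQ by (auto simp: h_def H_def Ix_def)
      have Gh: "h p = Some (G h p)" if "p \<in> lifted_points U r" "h p \<noteq> None" for p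
        using G hH that by blast
      have "h (x, y) = Some True" using xy(1) by (simp add: h_def term_concept_def)
      then have "G h (x, y)" using Gh[OF xy(1)] by simp
      moreover have "h (x', y') = Some False"
      proof -
        \<comment> \<open>A positive literal keeps the second point off the 1-side:
          \<open>y'\<close> reads 1 at the address of \<open>x\<close> but 0 at that of
          \<open>x'\<close>.\<close>
        obtain u where u: "u \<in> P" using PQU by blast
        have "x u \<in> y' u" "x' u \<notin> y' u" using u sat xy(2) PQU(1) by (auto simp: lifted_points_def)
        then have "x' u \<noteq> x u" by auto
        then have "\<not> (\<forall>u\<in>P \<union> Q. x' u = restrict x (P \<union> Q) u)" using u by auto
        moreover have "\<forall>u\<in>P \<union> Q. restrict x (P \<union> Q) u \<in> y' u \<longleftrightarrow> u \<in> P" using sat by simp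
        ultimately show ?thesis using xy(2) by (simp add: h_def term_concept_def)
      qed
      then have "\<not> G h (x', y')" using Gh[OF xy(2)] by simp
      ultimately have "h \<in> \<kappa> (x, y)" "h \<notin> \<kappa> (x', y')" using hH by (auto simp: \<kappa>_def)
      then show False using eq by simp
    qed
    moreover have "(card H + 1) ^ (2 ^ d) \<le> r ^ c"
      by (rule order_trans[OF power_mono d]) (use cardH in auto)
    ultimately show "\<exists>S\<subseteq>lifted_points U r. finite S \<and> card S = d \<and> (\<forall>y. \<exists>h\<in>H. \<forall>x\<in>S. G h x = y x)"
      unfolding \<kappa>_def by (intro many_columns_shattered[OF finH]) simp
  qed
  ultimately show ?thesis by (rule that)
qed

section \<open>Choice of the parameters\<close>

lemma exp_minus_le_half_power:
  assumes "real n \<le> x"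
  shows "exp (- x) \<le> (1 / 2) ^ n"
proof -
  have "exp (- x) \<le> exp (real n * (- 1))" using assms by simp
  also have "\<dots> = exp (- 1) ^ n" by (rule exp_of_nat_mult)
  also have "\<dots> \<le> (1 / 2) ^ n"
  proof (rule power_mono)
    have "2 \<le> exp (1 :: real)" using exp_ge_add_one_self[of 1] by simp
    then show "exp (- 1 :: real) \<le> 1 / 2" by (simp add: exp_minus field_simps)
  qed simp
  finally show ?thesis .
qed

text \<open>With \<open>m = 2 * d + 40\<close> this says that \<open>s = 2 ^ m\<close> exceeds the
  loss in \<open>2 * w * 2 ^ d \<le> c\<close>: the factor is \<open>64 * 2 * 640\<close>, from
  \<open>64 * c = s ^ 4\<close> and \<open>w \<le> 640 * m ^ 3 * s ^ 3\<close>. One step at most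
  quadruples the left side.\<close>

lemma cubic_times_exponential_le: "81920 * (2 * d + 40) ^ 3 * 2 ^ d \<le> (2::nat) ^ (2 * d + 40)"
proof (induction d)
  case (Suc d)
  define a where "a = d + 20"
  have a: "20 \<le> a" by (simp add: a_def)
  then have "20 * a \<le> a * a" by (rule mult_le_mono1)
  then have "3 * a + 1 \<le> a * a" using a by linarith
  moreover have "7 * (a * a) \<le> a * (a * a)" using a by (intro mult_le_mono1) simp
  moreover have "(a + 1) ^ 3 = a * (a * a) + 3 * (a * a) + 3 * a + 1"
    by (simp add: power3_eq_cube algebra_simps)
  moreover have "2 * a ^ 3 = a * (a * a) + a * (a * a)" by (simp add: power3_eq_cube)
  ultimately have "(a + 1) ^ 3 \<le> 2 * a ^ 3" by linarith
  then have "(2 * (a + 1)) ^ 3 \<le> 2 * (2 * a) ^ 3" by (simp only: power_mult_distrib) simp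
  then have "(2 * Suc d + 40) ^ 3 \<le> 2 * (2 * d + 40) ^ 3" by (simp add: a_def)
  then have "81920 * (2 * Suc d + 40) ^ 3 * 2 ^ Suc d \<le> 81920 * (2 * (2 * d + 40) ^ 3) * 2 ^ Suc d"
    by (intro mult_le_mono) auto
  also have "\<dots> = 4 * (81920 * (2 * d + 40) ^ 3 * 2 ^ d)" by simp
  also have "\<dots> \<le> 4 * 2 ^ (2 * d + 40)" by (intro mult_le_mono Suc) simp
  also have "\<dots> = 2 ^ (2 + (2 * d + 40))" by (simp only: power_add) simp
  also have "2 + (2 * d + 40) = 2 * Suc d + 40" by simp
  finally show ?case .
qed simp

lemma exists_forcing_class:
  fixes d :: nat
  obtains V :: "((nat \<times> (nat \<times> nat + nat \<times> nat) + nat set \<times> nat \<times> nat \<Rightarrow> nat) \<times>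
      (nat \<times> (nat \<times> nat + nat \<times> nat) + nat set \<times> nat \<times> nat \<Rightarrow> nat set)) set" and H
  where "finite V" "card V \<le> 2 ^ (2 ^ (4000 * (d + 1)))" "thin H" "partial_class V H" "forces d V H"
proof -
  define m where "m = 2 * d + 40"
  define s where "s = (2::nat) ^ m"
  define k where "k = 16 * m * s ^ 3"
  \<comment> \<open>This gives \<open>2 ^ l = 64 * c\<close> addresses, more than the
    \<open>2 * c\<close> variables that may be fixed.\<close>
  define l where "l = 4 * m"
  define b where "b = 8 * m * k"
  define w where "w = l * (2 * k + b)"
  \<comment> \<open>\<open>2 * c\<close> is \<open>s ^ 4 / 32\<close>, the number of fixed variables
    that the line certificates tolerate.\<close>
  define c where "c = (2::nat) ^ (4 * m - 6)"
  \<comment> \<open>The failure exponent is \<open>t / (64 * w ^ 2)\<close>. As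
    \<open>w \<le> s ^ 6\<close>, it is at least \<open>s ^ 26\<close>, far above the exponents of
    order \<open>s ^ 11\<close> that it must beat.\<close>
  define t where "t = s ^ 40"
  define r where "r = t ^ 2"
  have m: "40 \<le> m" and m7: "7 \<le> m" by (simp_all add: m_def)
  have s_pow: "s ^ i = 2 ^ (m * i)" for i by (simp add: s_def power_mult)
  have growth: "81920 * m ^ 3 * 2 ^ d \<le> s"
    unfolding s_def m_def by (rule cubic_times_exponential_le)
  have "m * 1 \<le> m ^ 3 * 2 ^ d" using m by (intro mult_le_mono) (auto simp: power3_eq_cube)
  then have ms: "16 * m \<le> s" and s16: "40 \<le> m" "640 \<le> s" using growth m by auto
  have s_mono: "s ^ i \<le> s ^ j" if "i \<le> j" for i j using that s16 by (intro power_increasing) auto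
  have s_pos: "0 < s ^ i" for i using s16 by simp
  have c64: "64 * c = s ^ 4"
  proof -
    have "64 * c = 2 ^ (6 + (4 * m - 6))" unfolding c_def power_add by simp
    also have "6 + (4 * m - 6) = m * 4" using m by simp
    finally show ?thesis by (simp add: s_pow)
  qed
  have l_pow: "2 ^ l = s ^ 4" by (simp add: s_pow l_def mult.commute)
  have m3: "m ^ 2 \<le> m ^ 3" using m by (intro power_increasing) auto
  have w640: "w \<le> 640 * m ^ 3 * s ^ 3"
  proof -
    have "w = (128 * m ^ 2 + 512 * m ^ 3) * s ^ 3"
      by (simp add: w_def l_def k_def b_def algebra_simps power2_eq_square power3_eq_cube)
    also have "\<dots> \<le> (640 * m ^ 3) * s ^ 3" using m3 by (intro mult_le_mono1) simp
    finally show ?thesis .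
  qed
  have "(16 * m) ^ 3 \<le> s ^ 3" using ms by (rule power_mono) simp
  then have m3s: "4096 * m ^ 3 \<le> s ^ 3" by (simp add: power_mult_distrib)
  have w6: "w \<le> s ^ 6"
  proof -
    have "640 * m ^ 3 * s ^ 3 \<le> s ^ 3 * s ^ 3" using m3s by (intro mult_le_mono1) simp
    then show ?thesis using w640 by (simp flip: power_add)
  qed
  have k1: "1 \<le> k" using m s_pos[of 3] by (simp add: k_def)
  have "1 * 1 \<le> l * (2 * k + b)" using m k1 by (intro mult_le_mono) (simp_all add: l_def)
  then have w1: "1 \<le> w" by (simp add: w_def)
  have wd: "2 * w * 2 ^ d \<le> c"
  proof -
    have "64 * (2 * w * 2 ^ d) \<le> 64 * (2 * (640 * m ^ 3 * s ^ 3) * 2 ^ d)"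
      using w640 by (intro mult_le_mono) auto
    also have "\<dots> = (81920 * m ^ 3 * 2 ^ d) * s ^ 3" by simp
    also have "\<dots> \<le> s * s ^ 3" by (rule mult_le_mono1[OF growth])
    also have "\<dots> = 64 * c" using c64 by (simp flip: power_Suc)
    finally show ?thesis by simp
  qed
  obtain U :: "(nat \<times> nat + nat \<times> nat) set" and CA where cert:
    "finite U" "card U = s ^ 4 + 2 * s ^ 5"
    "\<And>z P Q. (P, Q) \<in> CA z \<Longrightarrow> P \<union> Q \<subseteq> U \<and> P \<inter> Q = {} \<and> P \<noteq> {} \<and> card (P \<union> Q) \<le> 2 * k"
    "\<And>c c'. c \<in> CA False \<Longrightarrow> c' \<in> CA True \<Longrightarrow> conflict c c'"
    "\<And>I z. I \<subseteq> U \<Longrightarrow> 32 * card I \<le> s ^ 4 \<Longrightarrow> \<exists>(P, Q)\<in>CA z. P \<inter> I = {}"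
    "finite (CA False \<union> CA True)" "card (CA False \<union> CA True) \<le> 2 ^ b"
    by (rule exists_line_certs[OF m7, folded s_def, folded k_def, folded b_def]) (rule that)
  have av: "\<exists>(P, Q)\<in>CA z. P \<inter> I = {}" if "I \<subseteq> U" "card I \<le> 2 * c" for I z
    using cert(5)[OF that(1), of z] that(2) c64 by simp
  have "2 * c < 64 * c" by (simp add: c_def)
  then have cl: "2 * c < 2 ^ l" "0 < l" unfolding c64 l_pow using m by (simp_all add: l_def)
  obtain W :: "(nat \<times> (nat \<times> nat + nat \<times> nat) + nat set \<times> nat \<times> nat) set" and TT where W:
    "finite W" "card W = l * card U + 2 ^ l * (l * b)"
    "finite TT" "card TT \<le> 2 ^ (l * (1 + b))"
    "\<And>P Q. (P, Q) \<in> TT \<Longrightarrow> P \<union> Q \<subseteq> W \<and> P \<inter> Q = {} \<and> P \<noteq> {} \<and> card (P \<union> Q) \<le> w"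
    "\<And>T T'. T \<in> TT \<Longrightarrow> T' \<in> TT \<Longrightarrow> T \<noteq> T' \<Longrightarrow> conflict T T'"
    "\<And>I. I \<subseteq> W \<Longrightarrow> card I \<le> 2 * c \<Longrightarrow> \<exists>(P, Q)\<in>TT. P \<inter> I = {}"
    by (rule exists_terms[of U CA "2 * k" "2 * c" b l, folded w_def])
      (rule cert(1,3,4,6,7) av cl that; (assumption+)?)+
  have cardTT: "card TT \<le> 2 ^ w"
  proof -
    have "l * (1 + b) \<le> w" unfolding w_def using k1 by (intro mult_le_mono) auto
    then have "2 ^ (l * (1 + b)) \<le> (2::nat) ^ w" by (intro power_increasing) auto
    then show ?thesis using W(4) by (rule order_trans[rotated])
  qed
  have N: "card W \<le> s ^ 11"
  proof -
    have "s ^ 4 + 2 * s ^ 5 \<le> 3 * s ^ 5" using s_mono[of 4 5] by simp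
    then have "l * card U \<le> l * (3 * s ^ 5)" unfolding cert(2) by (rule mult_le_mono2)
    also have "\<dots> \<le> s * s ^ 5" using ms by (simp add: l_def)
    also have "\<dots> \<le> s ^ 10" using s_mono[of 6 10] by (simp flip: power_Suc)
    finally have 1: "l * card U \<le> s ^ 10" .
    have "l * b = (512 * m ^ 3) * s ^ 3" by (simp add: l_def b_def k_def power3_eq_cube)
    also have "\<dots> \<le> s ^ 3 * s ^ 3" using m3s by (intro mult_le_mono1) simp
    finally have "2 ^ l * (l * b) \<le> s ^ 4 * (s ^ 3 * s ^ 3)" unfolding l_pow by (rule mult_le_mono2)
    then have 2: "2 ^ l * (l * b) \<le> s ^ 10" by (simp flip: power_add)
    have "2 * s ^ 10 \<le> s * s ^ 10" using s16 by (intro mult_le_mono1) simp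
    then show ?thesis using 1 2 unfolding W(2) by (simp flip: power_Suc)
  qed
  have r_pow: "r = 2 ^ (80 * m)" unfolding r_def t_def s_def by (simp add: mult.commute flip: power_mult)
  have t2: "2 \<le> t" unfolding t_def using s_mono[of 1 40] s16 by simp
  have num: "real w * (2 * (2 * real r) ^ w * exp (- ((1 / (4 * real w))\<^sup>2 * real t / 4)))
      * 2 ^ card W * real r ^ c < 1"
  proof -
    \<comment> \<open>\<open>e\<close> collects the binary logarithms of all factors except the
      exponential, with \<open>real w\<close> bounded by \<open>2 ^ w\<close>.\<close>
    define e where "e = w + 1 + (80 * m + 1) * w + card W + 80 * m * c"
    have "real (s ^ 26) \<le> (1 / (4 * real w))\<^sup>2 * real t / 4"
    proof -
      have "64 * w ^ 2 * s ^ 26 \<le> s ^ 2 * (s ^ 6) ^ 2 * s ^ 26"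
      proof (intro mult_le_mono1 mult_le_mono)
        show "64 \<le> s ^ 2" using s16 s_mono[of 1 2] by simp
        show "w ^ 2 \<le> (s ^ 6) ^ 2" using w6 by (rule power_mono) simp
      qed
      also have "\<dots> = t" by (simp add: t_def flip: power_add power_mult)
      finally have "real (64 * w ^ 2 * s ^ 26) \<le> real t" by (rule of_nat_mono)
      then show ?thesis using w1 by (simp add: field_simps power2_eq_square)
    qed
    then have ex: "exp (- ((1 / (4 * real w))\<^sup>2 * real t / 4)) \<le> (1 / 2) ^ (s ^ 26)"
      by (rule exp_minus_le_half_power)
    have "e < s ^ 26"
    proof -
      have m80: "80 * m \<le> 5 * s" using ms by simp
      have c4: "c \<le> s ^ 4" using c64 by simp
      have "80 * m * w \<le> (5 * s) * s ^ 6" using m80 w6 by (rule mult_le_mono)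
      moreover have "80 * m * c \<le> (5 * s) * s ^ 4" using m80 c4 by (rule mult_le_mono)
      ultimately have "80 * m * w \<le> 5 * s ^ 11" "80 * m * c \<le> 5 * s ^ 11" "w \<le> s ^ 11" "1 \<le> s ^ 11"
        using s_mono[of 7 11] s_mono[of 5 11] s_mono[of 6 11] w6 s_pos[of 11]
        by (simp_all flip: power_Suc add: mult.assoc)
      then have "e \<le> 14 * s ^ 11" using N by (simp add: e_def algebra_simps)
      also have "\<dots> < s * s ^ 11" using s16 by simp
      also have "\<dots> \<le> s ^ 26" using s_mono[of 12 26] by (simp flip: power_Suc)
      finally show ?thesis .
    qed
    have "real w * (2 * (2 * real r) ^ w * exp (- ((1 / (4 * real w))\<^sup>2 * real t / 4))) * 2 ^ card W * real r ^ c
      \<le> 2 ^ w * (2 * (2 * real r) ^ w * (1 / 2) ^ (s ^ 26)) * 2 ^ card W * real r ^ c"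
      using ex of_nat_less_two_power[of w, where 'a = real]
      by (intro mult_right_mono mult_mono) auto
    also have "\<dots> = 2 ^ e * (1 / 2) ^ (s ^ 26)"
    proof -
      have "2 * real r = 2 ^ (80 * m + 1)" by (simp add: r_pow)
      then have 1: "(2 * real r) ^ w = 2 ^ ((80 * m + 1) * w)" by (simp only: power_mult)
      have 2: "real r ^ c = 2 ^ (80 * m * c)" by (simp only: r_pow of_nat_power of_nat_numeral power_mult)
      show ?thesis unfolding 1 2 e_def by (simp only: power_add power_one_right mult_ac)
    qed
    also have "\<dots> = 2 ^ e / 2 ^ (s ^ 26)" by (simp add: power_one_over)
    also have "\<dots> < 1" using \<open>e < s ^ 26\<close> by (simp add: divide_less_eq)
    finally show ?thesis .
  qed
  have col: "((2 * r) ^ w + 1) ^ (2 ^ d) \<le> r ^ c"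
  proof -
    have r4: "4 \<le> r" using t2 power_mono[of 2 t 2] by (simp add: r_def)
    have "(2 * r) ^ w + 1 \<le> 2 * (2 * r) ^ w" using r4 by simp
    also have "\<dots> \<le> 2 ^ w * (2 * r) ^ w" using w1 power_increasing[of 1 w "2::nat"] by (intro mult_le_mono1) simp
    also have "\<dots> = (2 * (2 * r)) ^ w" by (rule power_mult_distrib[symmetric])
    also have "\<dots> \<le> (r ^ 2) ^ w"
      using mult_le_mono1[OF r4, of r] by (intro power_mono) (simp_all add: power2_eq_square)
    finally have "(2 * r) ^ w + 1 \<le> r ^ (2 * w)" by (simp add: power_mult)
    then have "((2 * r) ^ w + 1) ^ (2 ^ d) \<le> (r ^ (2 * w)) ^ (2 ^ d)" by (rule power_mono) simp
    also have "\<dots> = r ^ (2 * w * 2 ^ d)" by (simp only: power_mult)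
    also have "\<dots> \<le> r ^ c" using wd r4 by (intro power_increasing) auto
    finally show ?thesis .
  qed
  obtain H where H: "thin H" "partial_class (lifted_points W r) H" "forces d (lifted_points W r) H"
    by (rule exists_lifted_class[OF W(1) t2 r_def w1 W(3) cardTT W(5,6,7) num col])
  have "card (lifted_points W r) \<le> 2 ^ (2 ^ (4000 * (d + 1)))"
  proof -
    have "card (lifted_points W r) \<le> r ^ card W * (2 ^ r) ^ card W" by (rule finite_lifted_points[OF W(1)])
    also have "r ^ card W = 2 ^ (80 * m * card W)" by (simp only: r_pow power_mult)
    also have "2 ^ (80 * m * card W) * (2 ^ r) ^ card W = (2::nat) ^ ((80 * m + r) * card W)"
      by (simp only: power_add add_mult_distrib power_mult[of _ r])
    \<comment> \<open>The exponent is at most \<open>s ^ 92 = 2 ^ (92 * m)\<close>, and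
      \<open>92 * m = 184 * d + 3680\<close>; this is the source of 4000.\<close>
    also have "\<dots> \<le> 2 ^ (2 ^ (4000 * (d + 1)))"
    proof (intro power_increasing)
      have r80: "r = s ^ 80" by (simp add: r_def t_def flip: power_mult)
      have "80 * m \<le> s ^ 80"
      proof -
        have "80 * m \<le> s * s" using ms s16 by (simp add: mult_le_mono)
        also have "\<dots> \<le> s ^ 80" using s_mono[of 2 80] by (simp add: power2_eq_square)
        finally show ?thesis .
      qed
      then have "80 * m + r \<le> 2 * s ^ 80" using r80 by simp
      then have "(80 * m + r) * card W \<le> (2 * s ^ 80) * s ^ 11" using N by (rule mult_le_mono)
      also have "\<dots> = 2 * s ^ 91" by (simp flip: power_add)
      also have "\<dots> \<le> s * s ^ 91" using s16 by (intro mult_le_mono1) simp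
      also have "\<dots> = 2 ^ (m * 92)" by (simp flip: s_pow power_Suc)
      also have "\<dots> \<le> 2 ^ (4000 * (d + 1))" by (intro power_increasing) (auto simp: m_def)
      finally show "(80 * m + r) * card W \<le> 2 ^ (4000 * (d + 1))" .
    qed simp
    finally show ?thesis .
  qed
  with finite_lifted_points(1)[OF W(1)] show ?thesis using H by (rule that)
qed

lemma exists_forcing_class_in:
  fixes A :: "'a set"
  assumes "finite A" "2 ^ (2 ^ (4000 * (d + 1))) \<le> card A"
  shows "\<exists>V H. V \<subseteq> A \<and> thin H \<and> partial_class V H \<and> forces d V H"
proof -
  obtain V :: "((nat \<times> (nat \<times> nat + nat \<times> nat) + nat set \<times> nat \<times> nat \<Rightarrow> nat) \<times>
      (nat \<times> (nat \<times> nat + nat \<times> nat) + nat set \<times> nat \<times> nat \<Rightarrow> nat set)) set" and H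
    where VH: "finite V" "card V \<le> 2 ^ (2 ^ (4000 * (d + 1)))" "thin H" "partial_class V H" "forces d V H"
    by (rule exists_forcing_class[of d])
  from VH(2) assms(2) have "card V \<le> card A" by (rule order_trans)
  then obtain f where f: "f ` V \<subseteq> A" "inj_on f V" using card_le_inj[OF VH(1) assms(1)] by blast
  have "thin (transport f V ` H)" by (rule thin_transport[OF VH(3)])
  moreover have "partial_class (f ` V) (transport f V ` H)" by (rule partial_class_transport)
  moreover have "forces d (f ` V) (transport f V ` H)" by (rule forces_transport[OF VH(5) f(2)])
  ultimately show ?thesis using f(1) by blast
qed

lemma partial_class_mono: "partial_class V H \<Longrightarrow> V \<subseteq> X \<Longrightarrow> partial_class X H"
  by (auto simp: partial_class_def)

section \<open>The finite classes and the infinite class\<close>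

theorem theorem1p7:
  shows "(\<exists>C c :: real. C > 0 \<and> c > 0 \<and>
           (\<exists>N::nat. \<forall>n\<ge>N. \<exists>H :: (nat \<Rightarrow> bool option) set.
              partial_class {1..n} H \<and>
              (\<forall>X'. X' \<subseteq> {1..n} \<and> X' \<noteq> {} \<longrightarrow>
                 (\<exists>Hbar. disambiguation X' (restr H X') Hbar \<and> finite Hbar \<and>
                         real (card Hbar) \<le> C * real (card X') ^ 2)) \<and>
              (\<forall>Hbar. disambiguation {1..n} H Hbar \<longrightarrow>
                 ereal_of_enat (VC Hbar) \<ge> ereal (c * ln (ln (real n))))))
       \<and> (\<exists>H :: (nat \<Rightarrow> bool option) set. \<exists>C :: real.
              (\<forall>X'. finite X' \<and> X' \<noteq> {} \<longrightarrow>
                 (\<exists>Hbar. disambiguation X' (restr H X') Hbar \<and> finite Hbar \<and>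
                         real (card Hbar) \<le> C * real (card X') ^ 2)) \<and>
              (\<forall>Hbar. disambiguation UNIV H Hbar \<longrightarrow> VC Hbar = \<infinity>))"
proof -
  define M where "M = (\<lambda>d :: nat. (2::nat) ^ (2 ^ (4000 * (d + 1))))"
  have M_gt: "d < M d" for d
  proof -
    have "d < 4000 * (d + 1)" by simp
    also have "\<dots> < 2 ^ (4000 * (d + 1))" by (rule less_exp)
    also have "\<dots> < M d" unfolding M_def by (rule less_exp)
    finally show ?thesis .
  qed
  have M_mono: "M i \<le> M j" if "i \<le> j" for i j
    unfolding M_def using that by (intro power_increasing) auto
  have *: "\<exists>H :: (nat \<Rightarrow> bool option) set.
              partial_class {1..n} H \<and>
              (\<forall>X'. X' \<subseteq> {1..n} \<and> X' \<noteq> {} \<longrightarrow>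
                 (\<exists>Hbar. disambiguation X' (restr H X') Hbar \<and> finite Hbar \<and>
                         real (card Hbar) \<le> 2 * real (card X') ^ 2)) \<and>
              (\<forall>Hbar. disambiguation {1..n} H Hbar \<longrightarrow>
                 ereal_of_enat (VC Hbar) \<ge> ereal (1 / 12000 * ln (ln (real n))))"
    if n: "M 1 \<le> n" for n
  proof -
    \<comment> \<open>This sandwiches \<open>M d \<le> n < M (d + 1)\<close> with
      \<open>d = j - 1\<close>; starting from \<open>M 1\<close> ensures
      \<open>d \<ge> 1\<close>.\<close>
    define j where "j = (LEAST j. n < M j)"
    have j: "n < M j" unfolding j_def by (rule LeastI[where P = "\<lambda>j. n < M j", OF M_gt])
    have "\<not> j \<le> 1"
    proof
      assume "j \<le> 1"
      then have "M j \<le> M 1" by (rule M_mono)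
      then show False using j n by linarith
    qed
    then obtain d where d: "j = Suc d" "1 \<le> d" by (cases j) auto
    have "\<not> n < M d" using not_less_Least[of d "\<lambda>j. n < M j"] d(1) by (simp add: j_def)
    then have "M d \<le> card {1..n}" by simp
    then obtain V H where VH: "V \<subseteq> {1..n}" "thin H" "partial_class V H" "forces d V H"
      using exists_forcing_class_in[of "{1..n}" d] unfolding M_def by auto
    \<comment> \<open>Two logarithms turn \<open>n < M (d + 1)\<close> into
      \<open>4000 * (d + 2)\<close>, which is at most \<open>12000 * d\<close> for
      \<open>d \<ge> 1\<close>; hence the constant \<open>1 / 12000\<close>.\<close>
    have "ln (ln (real n)) \<le> 12000 * real d"
    proof -
      define e where "e = 4000 * (d + 2)"
      have "n < 2 ^ (2 ^ e)" using j unfolding d(1) M_def e_def by simp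
      then have "real n < real (2 ^ (2 ^ e))" by (rule of_nat_less_iff[THEN iffD2])
      moreover have n1: "1 < n" using M_gt[of 1] n by linarith
      ultimately have "ln (real n) \<le> ln (2 ^ (2 ^ e))" by simp
      also have "\<dots> = 2 ^ e * ln 2" by (simp add: ln_realpow)
      also have ln2: "ln 2 \<le> (1::real)" using ln_le_minus_one[of 2] by simp
      then have "2 ^ e * ln 2 \<le> (2::real) ^ e * 1" by (intro mult_left_mono) auto
      finally have "ln (real n) \<le> 2 ^ e" by simp
      moreover have "0 < ln (real n)" using n1 by simp
      ultimately have "ln (ln (real n)) \<le> ln (2 ^ e)" by simp
      also have "\<dots> = real e * ln 2" by (simp add: ln_realpow)
      also have "\<dots> \<le> real e * 1" using ln2 by (intro mult_left_mono) auto
      also have "\<dots> \<le> 12000 * real d" using d(2) by (simp add: e_def)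
      finally show ?thesis .
    qed
    then have lnln: "1 / 12000 * ln (ln (real n)) \<le> real d" by simp
    show ?thesis
    proof (rule exI[of _ H], intro conjI allI impI)
      show "partial_class {1..n} H" using VH(3,1) by (rule partial_class_mono)
      show "\<exists>Hbar. disambiguation X' (restr H X') Hbar \<and> finite Hbar \<and>
          real (card Hbar) \<le> 2 * real (card X') ^ 2" if "X' \<subseteq> {1..n} \<and> X' \<noteq> {}" for X'
        using that finite_subset by (intro thin_restr_disambiguation[OF VH(2)]) auto
      fix Hbar assume "disambiguation {1..n} H Hbar"
      with VH have "enat d \<le> VC Hbar"
        by (intro forces_disambiguation[OF VH(4) _ VH(1) order_refl]) (auto intro: finite_subset)
      then have "ereal_of_enat (enat d) \<le> ereal_of_enat (VC Hbar)" by (simp only: ereal_of_enat_le_iff)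
      moreover have "ereal_of_enat (enat d) = ereal (real d)" by simp
      ultimately have "ereal (real d) \<le> ereal_of_enat (VC Hbar)" by (rule subst[rotated])
      with lnln show "ereal (1 / 12000 * ln (ln (real n))) \<le> ereal_of_enat (VC Hbar)"
        by (meson ereal_less_eq(3) order_trans)
    qed
  qed
  have "\<exists>H :: (nat \<Rightarrow> bool option) set. \<exists>C :: real.
              (\<forall>X'. finite X' \<and> X' \<noteq> {} \<longrightarrow>
                 (\<exists>Hbar. disambiguation X' (restr H X') Hbar \<and> finite Hbar \<and>
                         real (card Hbar) \<le> C * real (card X') ^ 2)) \<and>
              (\<forall>Hbar. disambiguation UNIV H Hbar \<longrightarrow> VC Hbar = \<infinity>)"
  proof -
    \<comment> \<open>Disjoint blocks, one for each \<open>d\<close>. Concepts that share a defined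
      point come from the same block, so the union of the classes is again thin and the growth
      constant 2 serves all blocks at once.\<close>
    define A where "A = (\<lambda>d. prod_encode ` ({d} \<times> {..<M d}))"
    have finA: "finite (A d)" for d by (simp add: A_def)
    have "card (A d) = M d" for d
      by (simp add: A_def card_image card_cartesian_product inj_prod_encode)
    then have "\<forall>d. \<exists>V H. V \<subseteq> A d \<and> thin H \<and> partial_class V H \<and> forces d V H"
      using exists_forcing_class_in[OF finA] unfolding M_def by (metis order_refl)
    then obtain V H where VH: "\<And>d. V d \<subseteq> A d" "\<And>d. thin (H d)"
      "\<And>d. partial_class (V d) (H d)" "\<And>d. forces d (V d) (H d)"
      by metis
    have same: "d = d'" if "h \<in> H d" "h' \<in> H d'" "h x \<noteq> None" "h' x \<noteq> None" for d d' h h' x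
    proof -
      have "x \<in> A d" "x \<in> A d'"
        using VH(1,3) that unfolding partial_class_def by (meson subsetD)+
      then show ?thesis by (auto simp: A_def inj_eq[OF inj_prod_encode])
    qed
    have "thin (\<Union>d. H d)"
      unfolding thin_def
    proof (intro ballI allI impI, elim conjE)
      fix h h' x y assume h: "h \<in> (\<Union>d. H d)" "h' \<in> (\<Union>d. H d)"
        and v: "h x = Some True" "h' x = Some True" "h y = Some False" "h' y = Some False"
      then obtain d d' where "h \<in> H d" "h' \<in> H d'" by blast
      moreover from this have "d = d'" using same[of h d h' d' x] v by simp
      ultimately show "h = h'" using VH(2)[of d] v unfolding thin_def by blast
    qed
    note growth = thin_restr_disambiguation[OF this]
    have "VC Hbar = \<infinity>" if dis: "disambiguation UNIV (\<Union>d. H d) Hbar" for Hbar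
    proof -
      have ge: "enat d \<le> VC Hbar" for d
      proof (rule forces_disambiguation[OF VH(4) _ subset_UNIV _ dis])
        show "finite (V d)" using VH(1) finA by (rule finite_subset)
      qed blast
      show ?thesis
      proof (cases "VC Hbar")
        case (enat k)
        then show ?thesis using ge[of "Suc k"] by simp
      qed
    qed
    then show ?thesis using growth by (intro exI[of _ "\<Union>d. H d"] exI[of _ 2]) blast
  qed
  moreover have "0 < (2::real)" "0 < (1 / 12000 :: real)" by simp_all
  ultimately show ?thesis using * by blast
qed

end
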